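(* Let $\alpha:\mathbb{R}\to\mathbb{R}^2\equiv\{x_3=0\}\subset\mathbb{R}^3$ be a smooth, $L$-periodic, arc-length parametrized curve whose trace $C$ is a simple closed curve of length $L$, traversed counterclockwise, and let $\Omega$ be the bounded domain enclosed by $C$, with area $|\Omega|$. For $l>0$ let $M$ be the cylindrical column $x(t,s)=\alpha(s)+tE_3$, $t\in[0,l]$, $s\in[0,L]$, oriented by the Gauss map $N(t,s)=E_3\wedge\alpha'(s)$. Suppose $M$ is a rotating stationary surface, i.e. its mean curvature satisfies $2H=a(x_1^2+x_2^2)+b$ on $M$ for constants $a,b\in\mathbb{R}$ (equivalently, the curvature $\kappa$ of $\alpha$ satisfies $\kappa(s)=a|\alpha(s)|^2+b$). If $a>0$ and $M$ is stable, then $$l\le \frac{\pi}{2}\sqrt{\frac{L}{a|\Omega|}}.$$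
   Context: $E_1,E_2,E_3$ is the standard basis of $\mathbb{R}^3$, $\wedge$ the cross product. The curvature $\kappa$ of $\alpha$ is defined by $\alpha''=\kappa\,\mathbf{n}$ with $\mathbf{n}=J\alpha'$, $J$ the counterclockwise rotation by $\pi/2$ in the $x_1x_2$-plane (so $N=\mathbf{n}$ and $2H=\kappa$). For a surface $M$ with Gauss map $N$, second fundamental form $\sigma$, Laplace–Beltrami operator $\Delta$, support function $h=\langle N,x\rangle$, $N_3=\langle N,E_3\rangle$, $x_3=\langle x,E_3\rangle$, satisfying $2H=a(x_1^2+x_2^2)+b$, stability means: $\Phi(u):=-\int_M u\big(\Delta u+(|\sigma|^2-2a(h-x_3N_3))u\big)\,dM\ge 0$ for every smooth $u$ on $M$ vanishing on the boundary $\partial M$ (here: on $t=0$ and $t=l$, and $L$-periodic in $s$) with $\int_M u\,dM=0$. For the column, $\Delta=\partial_t^2+\partial_s^2$, $|\sigma|^2=\kappa(s)^2$ and $h-x_3N_3=-\langle\alpha(s)\wedge\alpha'(s),E_3\rangle$. *)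

theory Defs
  imports "HOL-Analysis.Analysis"
begin

definition vderiv :: "(real \<Rightarrow> real^2) \<Rightarrow> real \<Rightarrow> real^2" where
  "vderiv f = (\<lambda>x. vector_derivative f (at x))"

definition smooth_curve :: "(real \<Rightarrow> real^2) \<Rightarrow> bool" where
  "smooth_curve \<alpha> \<longleftrightarrow> (\<forall>n t. ((vderiv ^^ n) \<alpha>) differentiable (at t))"

definition rotJ :: "real^2 \<Rightarrow> real^2" where
  "rotJ v = (\<chi> i. if i = 1 then - (v$2) else v$1)"

definition curv :: "(real \<Rightarrow> real^2) \<Rightarrow> real \<Rightarrow> real" where
  "curv \<alpha> s = vderiv (vderiv \<alpha>) s \<bullet> rotJ (vderiv \<alpha> s)"

definition pd :: "bool \<Rightarrow> (real \<times> real \<Rightarrow> real) \<Rightarrow> real \<times> real \<Rightarrow> real" where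
  "pd b f = (\<lambda>(t,s). if b then deriv (\<lambda>\<tau>. f (\<tau>, s)) t else deriv (\<lambda>\<sigma>. f (t, \<sigma>)) s)"

definition smooth2 :: "(real \<times> real \<Rightarrow> real) \<Rightarrow> bool" where
  "smooth2 u \<longleftrightarrow> (\<forall>ops. \<forall>p. (fold pd ops u) differentiable (at p))"

definition ccw :: "(real \<Rightarrow> real^2) \<Rightarrow> (real^2) set \<Rightarrow> bool" where
  "ccw \<alpha> \<Omega> \<longleftrightarrow> (\<forall>s. \<exists>\<delta>>0. \<forall>\<epsilon>. 0 < \<epsilon> \<and> \<epsilon> < \<delta> \<longrightarrow> \<alpha> s + \<epsilon> *\<^sub>R rotJ (vderiv \<alpha> s) \<in> \<Omega>)"

text \<open>Potential of the Jacobi operator of the column: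
  |sigma|^2 - 2a(h - x3 N3) = kappa^2 + 2a <alpha wedge alpha', E3>.\<close>
definition jacobi_pot :: "real \<Rightarrow> (real \<Rightarrow> real^2) \<Rightarrow> real \<Rightarrow> real" where
  "jacobi_pot a \<alpha> s = (curv \<alpha> s)\<^sup>2
     + 2 * a * ((\<alpha> s)$1 * (vderiv \<alpha> s)$2 - (\<alpha> s)$2 * (vderiv \<alpha> s)$1)"

text \<open>Stability of the column of height l over alpha (coordinates (t,s), dM = dt ds).\<close>
definition stable_column :: "real \<Rightarrow> (real \<Rightarrow> real^2) \<Rightarrow> real \<Rightarrow> real \<Rightarrow> bool" where
  "stable_column a \<alpha> L l \<longleftrightarrow>
     (\<forall>u. smooth2 u
        \<and> (\<forall>s. u (0, s) = 0 \<and> u (l, s) = 0)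
        \<and> (\<forall>t s. u (t, s + L) = u (t, s))
        \<and> integral (cbox (0, 0) (l, L)) u = 0
      \<longrightarrow> - integral (cbox (0, 0) (l, L))
            (\<lambda>p. u p * (pd True (pd True u) p + pd False (pd False u) p
                          + jacobi_pot a \<alpha> (snd p) * u p)) \<ge> 0)"

end

theory Submission
  imports Defs "HOL-Complex_Analysis.Complex_Analysis" "HOL-Real_Asymp.Real_Asymp"
begin

text \<open>
  Test stability on \<open>sin (\<pi> t / l) n\<^sub>i(s)\<close> for the two components \<open>n\<^sub>1, n\<^sub>2\<close> of the normal. Each has mean
  zero because \<open>\<alpha>\<close> closes up, and since \<open>\<langle>n, n'' + \<kappa>\<^sup>2 n\<rangle> = 0\<close> the curvature drops out of the sum
  of the two inequalities, which reads \<open>2a \<integral> \<langle>\<alpha> \<and> \<alpha>', E\<^sub>3\<rangle> ds \<le> (\<pi>/l)\<^sup>2 L\<close>. The integral on the left is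
  \<open>2|\<Omega>|\<close>.

  This last identity is obtained by integrating the winding number of the curve over the
  rectangle \<open>[-R, R] \<times> [-r, r]\<close>. By Fubini one may integrate the Cauchy kernel over the rectangle first;
  along horizontal lines it has a primitive made of logarithms and arctangents, and as \<open>R \<rightarrow> \<infinity>\<close>
  the result tends to \<open>-2\<pi> y dx\<close>. On the other hand the winding number is \<open>\<plusminus>1\<close> inside and \<open>0\<close>
  outside. The sign is found at the point farthest from the origin, by comparing the
  winding number on both sides of the curve.
\<close>

section \<open>The plane as \<open>real^2\<close>, \<open>complex\<close> and \<open>real \<times> real\<close>\<close>

text \<open>The complement of a convex set containing \<open>S\<close> lies in the outside of
  \<open>S\<close>. Applied to a disc, this bounds the region enclosed by the curve.\<close>

lemma inside_subset_convex:
  fixes S C :: "'a::{real_normed_vector, perfect_space} set"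
  assumes "convex C" "S \<subseteq> C"
  shows "inside S \<subseteq> C"
  using outside_subset_convex[OF assms] inside_Int_outside[of S] by blast

text \<open>Membership in \<open>inside\<close> depends only on the components of the complement and
  on their boundedness. The map \<open>f\<close> is a homeomorphism of the complements, and
  \<open>f\<close> and \<open>g\<close> both preserve boundedness.\<close>

lemma inside_linear_homeomorphic_image:
  fixes f :: "'a::real_normed_vector \<Rightarrow> 'b::real_normed_vector"
  assumes f: "bounded_linear f" and g: "bounded_linear g"
    and gf: "\<And>x. g (f x) = x" and fg: "\<And>y. f (g y) = y"
  shows "inside (f ` S) = f ` inside S"
proof -
  have hom: "homeomorphism (- S) (- f ` S) f g"
    unfolding homeomorphism_def
  proof (intro conjI ballI)
    show "f ` (- S) = - f ` S"
      by (rule bij_image_Compl_eq, rule bijI') (use gf fg in metis)+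
    then show "g ` (- f ` S) = - S" by (metis (no_types, lifting) gf image_cong image_ident image_image)
  qed (use gf fg f g in \<open>auto intro: linear_continuous_on\<close>)
  have bounded: "bounded (f ` X) \<longleftrightarrow> bounded X" for X
  proof
    assume "bounded (f ` X)"
    then have "bounded (g ` f ` X)" using g by (rule bounded_linear_image)
    then show "bounded X" by (simp add: image_image gf)
  qed (rule bounded_linear_image[OF _ f])
  have eq: "f x \<in> inside (f ` S) \<longleftrightarrow> x \<in> inside S" for x
  proof (cases "x \<in> S")
    case False
    then have "f x \<notin> f ` S" by (metis gf image_iff)
    with False show ?thesis
      unfolding inside_def using connected_component_set_homeomorphism[OF hom, of x] bounded by simp
  qed (auto simp: inside_def)
  show ?thesis
  proof (intro subset_antisym subsetI)
    fix y assume "y \<in> inside (f ` S)"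
    then have "g y \<in> inside S" using eq[of "g y"] by (simp add: fg)
    then show "y \<in> f ` inside S" using fg[of y] by (metis imageI)
  qed (use eq in auto)
qed

section \<open>Identification of \<open>real^2\<close> with the complex plane\<close>

definition complex_of_vec :: "real^2 \<Rightarrow> complex" where
  "complex_of_vec v = Complex (v$1) (v$2)"

lemma bounded_linear_complex_of_vec: "bounded_linear complex_of_vec"
  unfolding complex_of_vec_def Complex_eq
  by (intro bounded_linear_add bounded_linear_const_mult bounded_linear_compose[OF bounded_linear_of_real] bounded_linear_vec_nth)

lemma bounded_linear_vec_of_complex: "bounded_linear (\<lambda>z. vector [Re z, Im z] :: real^2)"
proof -
  have "linear (\<lambda>z. vector [Re z, Im z] :: real^2)"
    by (intro linearI) (auto simp: vec_eq_iff forall_2)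
  then show ?thesis by (simp add: linear_conv_bounded_linear)
qed

lemma norm_complex_of_vec [simp]: "norm (complex_of_vec v) = norm v"
  by (simp add: complex_of_vec_def cmod_def norm_vec_def L2_set_def sum_2)

lemma complex_of_vec_inject [simp]: "complex_of_vec v = complex_of_vec w \<longleftrightarrow> v = w"
  by (simp add: complex_of_vec_def vec_eq_iff forall_2)

lemma complex_of_vec_add: "complex_of_vec (v + w) = complex_of_vec v + complex_of_vec w"
  and complex_of_vec_scaleR: "complex_of_vec (c *\<^sub>R v) = of_real c * complex_of_vec v"
  by (simp_all add: complex_of_vec_def complex_eq_iff)

lemma complex_of_vec_rotJ: "complex_of_vec (rotJ v) = \<i> * complex_of_vec v"
  by (simp add: complex_of_vec_def rotJ_def complex_eq_iff)

lemma inside_complex_of_vec: "inside (complex_of_vec ` S) = complex_of_vec ` inside S"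
  by (rule inside_linear_homeomorphic_image[OF bounded_linear_complex_of_vec bounded_linear_vec_of_complex])
    (auto simp: complex_of_vec_def vec_eq_iff forall_2)

text \<open>Both measures give a box the product of its side lengths, and this determines Lebesgue
  measure. It lets an area in \<open>real^2\<close> be computed on
  \<open>real \<times> real\<close>, where Fubini applies.\<close>

lemma lborel_vec2_eq_distr:
  "(lborel :: (real^2) measure) = distr lborel borel (\<lambda>w. vector [fst w, snd w])"
proof (rule lborel_eqI)
  let ?f = "\<lambda>w::real \<times> real. vector [fst w, snd w] :: real^2"
  have "linear ?f" by (intro linearI) (auto simp: vec_eq_iff forall_2)
  then have f: "?f \<in> borel_measurable lborel"
    by (simp add: borel_measurable_continuous_onI linear_continuous_on linear_conv_bounded_linear)
  have B2: "(Basis :: (real^2) set) = {axis 1 1, axis 2 1}"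
    by (auto simp: Basis_vec_def UNIV_2)
  fix l u :: "real^2" assume le: "\<And>b. b \<in> Basis \<Longrightarrow> l \<bullet> b \<le> u \<bullet> b"
  have le': "l$1 \<le> u$1" "l$2 \<le> u$2" using le[of "axis 1 1"] le[of "axis 2 1"] by (auto simp: B2 inner_axis)
  have "emeasure (distr lborel borel ?f) (box l u) = emeasure lborel (?f -` box l u)"
    using f by (subst emeasure_distr) auto
  also have "?f -` box l u = box (l$1, l$2) (u$1, u$2)"
    by (auto simp: mem_box_cart forall_2 mem_box Basis_prod_def)
  also have "emeasure lborel (box (l$1, l$2) (u$1, u$2)) = (\<Prod>b\<in>Basis. ((u$1, u$2) - (l$1, l$2)) \<bullet> b)"
    by (rule emeasure_lborel_box) (use le' in \<open>auto simp: Basis_prod_def\<close>)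
  also have "(\<Prod>b\<in>Basis. ((u$1, u$2) - (l$1, l$2)) \<bullet> b) = (u$1 - l$1) * (u$2 - l$2)"
    by (simp add: Basis_prod_def)
  also have "\<dots> = (\<Prod>b\<in>Basis. (u - l) \<bullet> b)"
    by (simp add: B2 axis_eq_axis inner_axis)
  finally show "emeasure (distr lborel borel ?f) (box l u) = (\<Prod>b\<in>Basis. (u - l) \<bullet> b)" .
qed simp

text \<open>The enclosed area is given in \<open>real^2\<close>, winding numbers live on
  \<open>complex\<close>, and the integrals are taken over \<open>real \<times> real\<close>; this
  joins the three.\<close>

lemma measure_lebesgue_vec2:
  fixes A :: "(real^2) set"
  assumes "A \<in> sets borel"
  shows "measure lebesgue A = measure lborel {w. Complex (fst w) (snd w) \<in> complex_of_vec ` A}"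
proof -
  let ?f = "\<lambda>w::real \<times> real. vector [fst w, snd w] :: real^2"
  have "linear ?f" by (intro linearI) (auto simp: vec_eq_iff forall_2)
  then have f: "?f \<in> borel_measurable lborel"
    by (simp add: borel_measurable_continuous_onI linear_continuous_on linear_conv_bounded_linear)
  have "measure lebesgue A = measure lborel A" using assms by (simp add: measure_completion)
  also have "\<dots> = measure lborel (?f -` A)"
    by (subst lborel_vec2_eq_distr, subst measure_distr) (use f assms in auto)
  also have "?f -` A = {w. Complex (fst w) (snd w) \<in> complex_of_vec ` A}"
  proof -
    have "Complex (fst w) (snd w) = complex_of_vec (?f w)" for w by (simp add: complex_of_vec_def)
    then show ?thesis by (auto simp: inj_image_mem_iff[OF injI[of complex_of_vec]])
  qed
  finally show ?thesis .
qed

section \<open>Integrals of the Cauchy kernel over rectangles\<close>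

text \<open>An inverse square root singularity is integrable. The bound is uniform in
  \<open>c\<close>, so it serves all points of the curve at once.\<close>

lemma nn_integral_inverse_sqrt_abs_le:
  fixes c R :: real
  assumes c: "\<bar>c\<bar> \<le> R"
  shows "(\<integral>\<^sup>+u. ennreal (indicator {-R..R} u / sqrt \<bar>c - u\<bar>) \<partial>lborel) \<le> ennreal (4 * sqrt (2 * R))"
proof -
  \<comment> \<open>Since \<open>sqrt\<close> is an odd function on all reals,
    \<open>2 * sqrt (u - c)\<close> is a primitive on both sides of the singularity and is
    continuous across \<open>u = c\<close>, the one exceptional point.\<close>
  have "((\<lambda>u. 1 / sqrt \<bar>c - u\<bar>) has_integral (2 * sqrt (R - c) - 2 * sqrt (- R - c))) {-R..R}"
  proof (rule fundamental_theorem_of_calculus_interior_strong[where S = "{c}"])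
    fix x assume "x \<in> {-R<..<R} - {c}"
    then have "x - c \<noteq> 0" by auto
    then have "(sqrt has_field_derivative 1 / sqrt \<bar>x - c\<bar> / 2) (at (x - c))"
      by (intro DERIV_real_sqrt_generic) (use real_sqrt_minus[of "x - c"] in \<open>simp_all add: inverse_eq_divide\<close>)
    then have "((\<lambda>u. sqrt (u - c)) has_field_derivative 1 / sqrt \<bar>x - c\<bar> / 2) (at x)"
      using DERIV_shift[of sqrt _ x "-c"] by simp
    from DERIV_cmult[OF this, of 2]
    have "((\<lambda>u. 2 * sqrt (u - c)) has_field_derivative 1 / sqrt \<bar>c - x\<bar>) (at x)"
      by (simp add: abs_minus_commute)
    then show "((\<lambda>u. 2 * sqrt (u - c)) has_vector_derivative 1 / sqrt \<bar>c - x\<bar>) (at x)"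
      by (simp add: has_real_derivative_iff_has_vector_derivative)
  qed (use c in \<open>auto intro!: continuous_intros\<close>)
  then have "((\<lambda>u. indicator {-R..R} u / sqrt \<bar>c - u\<bar>) has_integral (2 * sqrt (R - c) - 2 * sqrt (- R - c))) UNIV"
    by (subst (asm) has_integral_restrict_UNIV[symmetric]) (simp add: indicator_def of_bool_def if_distrib[of "\<lambda>x. x / _"] cong: if_cong)
  then have "(\<integral>\<^sup>+u. ennreal (indicator {-R..R} u / sqrt \<bar>c - u\<bar>) \<partial>lborel) = ennreal (2 * sqrt (R - c) - 2 * sqrt (- R - c))"
    by (intro nn_integral_has_integral_lborel) auto
  also have "\<dots> \<le> ennreal (4 * sqrt (2 * R))"
  proof (rule ennreal_leI)
    have "sqrt (R - c) \<le> sqrt (2 * R)" "sqrt (R + c) \<le> sqrt (2 * R)" using c by auto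
    moreover have "sqrt (- R - c) = - sqrt (R + c)"
      using real_sqrt_minus[of "R + c"] by simp
    ultimately show "2 * sqrt (R - c) - 2 * sqrt (- R - c) \<le> 4 * sqrt (2 * R)" by linarith
  qed
  finally show ?thesis .
qed

text \<open>For a moving point \<open>z\<close> with velocity \<open>z'\<close> this is its angular
  speed as seen from \<open>Complex u v\<close>. Integrated along a curve it gives
  \<open>2 * pi\<close> times the real part of the winding number.\<close>

definition winding_kernel :: "complex \<Rightarrow> complex \<Rightarrow> real \<Rightarrow> real \<Rightarrow> real" where
  "winding_kernel z z' u v = Im (z' / (z - Complex u v))"

lemma winding_kernel_eq:
  "winding_kernel z z' u v =
     (Im z' * (Re z - u) - Re z' * (Im z - v)) / ((Re z - u)\<^sup>2 + (Im z - v)\<^sup>2)"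
  by (simp add: winding_kernel_def Im_divide)

text \<open>The distance in the denominator is at least the geometric mean of the horizontal and the
  vertical distance. The bound is thus a product of functions of \<open>u\<close> and of
  \<open>v\<close> with integrable singularities, ready for Tonelli.\<close>

lemma abs_winding_kernel_le:
  assumes "u \<noteq> Re z" "v \<noteq> Im z"
  shows "\<bar>winding_kernel z z' u v\<bar> \<le> norm z' * (1 / sqrt \<bar>Re z - u\<bar> * (1 / sqrt \<bar>Im z - v\<bar>))"
proof -
  let ?p = "\<bar>Re z - u\<bar>" and ?q = "\<bar>Im z - v\<bar>"
  have pos: "?p > 0" "?q > 0" using assms by auto
  have "?p * ?q \<le> ?p\<^sup>2 + ?q\<^sup>2"
    using sum_squares_bound[of ?p ?q] pos mult_pos_pos[of ?p ?q] by linarith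
  then have "sqrt (?p * ?q) \<le> sqrt (?p\<^sup>2 + ?q\<^sup>2)" by (rule real_sqrt_le_mono)
  also have "sqrt (?p\<^sup>2 + ?q\<^sup>2) = norm (z - Complex u v)" by (simp add: cmod_def)
  finally have le: "sqrt ?p * sqrt ?q \<le> norm (z - Complex u v)" by (simp add: real_sqrt_mult)
  have "\<bar>winding_kernel z z' u v\<bar> \<le> norm z' / norm (z - Complex u v)"
    unfolding winding_kernel_def by (metis abs_Im_le_cmod norm_divide)
  also have "\<dots> \<le> norm z' / (sqrt ?p * sqrt ?q)"
    using le pos by (intro divide_left_mono mult_pos_pos) auto
  finally show ?thesis by simp
qed

lemma borel_measurable_Complex [measurable]:
  assumes [measurable]: "f \<in> borel_measurable M" "g \<in> borel_measurable M"
  shows "(\<lambda>x. Complex (f x) (g x)) \<in> borel_measurable M"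
  unfolding Complex_eq by measurable

text \<open>The line at height \<open>v\<close> avoids \<open>z\<close>, so the integrand is
  continuous. The logarithm of the squared distance is a primitive of the \<open>Im z'\<close> term
  and \<open>arctan ((Re z - u) / d)\<close> one of the \<open>Re z'\<close> term, up to constant
  factors.\<close>

lemma integral_winding_kernel_line:
  assumes v: "v \<noteq> Im z" and R: "R \<ge> 0"
  shows "(\<integral>u. indicator {-R..R} u * winding_kernel z z' u v \<partial>lborel) =
     Im z' * (ln ((R + Re z)\<^sup>2 + (Im z - v)\<^sup>2) - ln ((R - Re z)\<^sup>2 + (Im z - v)\<^sup>2)) / 2
     - Re z' * (arctan ((R - Re z) / (Im z - v)) + arctan ((R + Re z) / (Im z - v)))"
proof -
  define d where "d = Im z - v"
  have d: "d \<noteq> 0" using v by (simp add: d_def)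
  have pos: "(Re z - u)\<^sup>2 + d\<^sup>2 > 0" for u using d by (simp add: add_nonneg_pos)
  define F where "F u = - Im z' * ln ((Re z - u)\<^sup>2 + d\<^sup>2) / 2 + Re z' * arctan ((Re z - u) / d)" for u
  have "integral\<^sup>L lborel (\<lambda>u. indicator {-R..R} u *\<^sub>R winding_kernel z z' u v) = F R - F (-R)"
  proof (rule integral_FTC_atLeastAtMost)
    fix u
    have "(F has_field_derivative winding_kernel z z' u v) (at u)"
    proof -
      define D where "D = (Re z - u)\<^sup>2 + d\<^sup>2"
      have 1: "((\<lambda>u. ln ((Re z - u)\<^sup>2 + d\<^sup>2)) has_field_derivative - 2 * (Re z - u) / D) (at u)"
        unfolding D_def
        using pos[of u] by (auto intro!: derivative_eq_intros simp: field_simps)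
      have "((\<lambda>u. arctan ((Re z - u) / d)) has_field_derivative inverse (1 + ((Re z - u) / d)\<^sup>2) * (- 1 / d)) (at u)"
        using d by (auto intro!: derivative_eq_intros simp: field_simps)
      also have "inverse (1 + ((Re z - u) / d)\<^sup>2) * (- 1 / d) = - d / ((Re z - u)\<^sup>2 + d\<^sup>2)"
        using d pos[of u] by (simp add: power2_eq_square field_simps)
      finally have 2: "((\<lambda>u. arctan ((Re z - u) / d)) has_field_derivative - d / D) (at u)" unfolding D_def .
      have "(F has_field_derivative - Im z' * (- 2 * (Re z - u) / D) / 2
         + Re z' * (- d / D)) (at u)"
        unfolding F_def by (intro DERIV_add DERIV_cmult DERIV_cdivide 1 2)
      also have "- Im z' * (- 2 * (Re z - u) / D) / 2
         + Re z' * (- d / D) = winding_kernel z z' u v"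
        unfolding winding_kernel_eq d_def[symmetric] D_def[symmetric]
        by (simp add: diff_divide_distrib right_diff_distrib left_diff_distrib)
      finally show ?thesis .
    qed
    then show "(F has_vector_derivative winding_kernel z z' u v) (at u within {-R..R})"
      unfolding has_real_derivative_iff_has_vector_derivative[symmetric] by (rule DERIV_subset) simp
  next
    show "continuous_on {-R..R} (\<lambda>u. winding_kernel z z' u v)"
      unfolding winding_kernel_eq d_def[symmetric]
      by (intro continuous_intros) (use d in \<open>auto simp: sum_power2_eq_zero_iff\<close>)
  qed (use R in auto)
  moreover have "F R = - Im z' * ln ((R - Re z)\<^sup>2 + d\<^sup>2) / 2 - Re z' * arctan ((R - Re z) / d)"
  proof -
    have "arctan ((Re z - R) / d) = - arctan ((R - Re z) / d)"
      by (metis arctan_minus minus_diff_eq minus_divide_left)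
    then show ?thesis unfolding F_def power2_commute[of "Re z" R] by simp
  qed
  moreover have "F (- R) = - Im z' * ln ((R + Re z)\<^sup>2 + d\<^sup>2) / 2 + Re z' * arctan ((R + Re z) / d)"
    unfolding F_def by (simp add: add.commute)
  ultimately show ?thesis
    unfolding d_def[symmetric] by (simp add: diff_divide_distrib right_diff_distrib distrib_left)
qed

text \<open>For positive \<open>y = d / c\<close>, the angles \<open>arctan y\<close> and
  \<open>arctan (1 / y)\<close> add up to \<open>pi / 2\<close>, and
  \<open>0 \<le> arctan y \<le> y\<close>. Negative \<open>d\<close> follows because
  \<open>arctan\<close> is odd.\<close>

lemma abs_arctan_divide_sub_le:
  fixes c d :: real
  assumes "c > 0" "d \<noteq> 0"
  shows "\<bar>arctan (c / d) - sgn d * (pi / 2)\<bar> \<le> \<bar>d\<bar> / c"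
proof -
  have *: "\<bar>arctan (c / d) - pi / 2\<bar> \<le> d / c" if "d > 0" for d
  proof -
    have "arctan (1 / (d / c)) = sgn (d / c) * pi / 2 - arctan (d / c)"
      using arctan_inverse[of "d / c"] that assms(1) by simp
    then have "arctan (c / d) = pi / 2 - arctan (d / c)" using that assms(1) by simp
    moreover have "arctan (d / c) \<le> d / c" "arctan (d/c) \<ge> 0"
      using arctan_le_self[of "d/c"] that assms(1) by (auto simp: zero_le_arctan_iff)
    ultimately show ?thesis by simp
  qed
  show ?thesis
  proof (cases "d > 0")
    case True then show ?thesis using * by simp
  next
    case False
    then have "- d > 0" using assms by simp
    from *[OF this] False assms(2) show ?thesis
      by (simp add: arctan_minus abs_if split: if_splits)
  qed
qed

text \<open>The quotient of the two arguments of \<open>ln\<close> is largest at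
  \<open>x = r\<close>, \<open>d = 0\<close>, as cross-multiplication shows. Applied to
  \<open>x\<close> and \<open>- x\<close>, this bounds the absolute value of the difference.\<close>

lemma ln_quotient_sq_le:
  fixes x r R d :: real
  assumes x: "\<bar>x\<bar> \<le> r" and R: "r < R"
  shows "ln ((R + x)\<^sup>2 + d\<^sup>2) - ln ((R - x)\<^sup>2 + d\<^sup>2) \<le> 2 * ln ((R + r) / (R - r))"
proof -
  have p: "R - r > 0" "R + r > 0" "R - x > 0" "R + x > 0" "R - r \<le> R - x" "R + x \<le> R + r"
    "R - r \<le> R + r" using assms by auto
  have "((R + x)\<^sup>2 + d\<^sup>2) * (R - r)\<^sup>2 \<le> (R + r)\<^sup>2 * ((R - x)\<^sup>2 + d\<^sup>2)"
  proof -
    have "(R + x)\<^sup>2 * (R - r)\<^sup>2 \<le> (R + r)\<^sup>2 * (R - x)\<^sup>2"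
      using p by (intro mult_mono power_mono) auto
    moreover have "d\<^sup>2 * (R - r)\<^sup>2 \<le> d\<^sup>2 * (R + r)\<^sup>2"
      using p by (intro mult_left_mono power_mono) auto
    ultimately show ?thesis by (simp add: algebra_simps)
  qed
  then have "ln (((R + x)\<^sup>2 + d\<^sup>2) * (R - r)\<^sup>2) \<le> ln ((R + r)\<^sup>2 * ((R - x)\<^sup>2 + d\<^sup>2))"
    using p by (subst ln_le_cancel_iff) (auto intro!: mult_pos_pos add_pos_nonneg)
  then show ?thesis using p
    by (subst (asm) (1 2) ln_mult) (auto simp: ln_div ln_realpow add_pos_nonneg)
qed

text \<open>As \<open>R\<close> grows, the logarithms cancel and both arctangents tend to
  \<open>sgn (Im z - v) * (pi / 2)\<close>. The error does not involve \<open>v\<close>, so it can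
  be integrated over the height of the rectangle.\<close>

lemma integral_winding_kernel_line_approx:
  assumes v: "v \<noteq> Im z" "\<bar>Im z - v\<bar> \<le> h" and x: "\<bar>Re z\<bar> \<le> r" and R: "r < R"
  shows "\<bar>(\<integral>u. indicator {-R..R} u * winding_kernel z z' u v \<partial>lborel) + Re z' * pi * sgn (Im z - v)\<bar>
           \<le> norm z' * (ln ((R + r) / (R - r)) + 2 * h / (R - r))"
proof -
  define d where "d = Im z - v"
  have d: "d \<noteq> 0" "\<bar>d\<bar> \<le> h" using v by (auto simp: d_def)
  define l where "l = (ln ((R + Re z)\<^sup>2 + d\<^sup>2) - ln ((R - Re z)\<^sup>2 + d\<^sup>2)) / 2"
  define A where "A = arctan ((R - Re z) / d) - sgn d * (pi / 2)"
  define B where "B = arctan ((R + Re z) / d) - sgn d * (pi / 2)"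
  have l: "\<bar>l\<bar> \<le> ln ((R + r) / (R - r))"
    using ln_quotient_sq_le[OF x R, of d] ln_quotient_sq_le[of "- Re z" r R d] x R by (auto simp: l_def)
  have le: "\<bar>d\<bar> / c \<le> h / (R - r)" if "c \<ge> R - r" for c
    using that d R by (intro frac_le) auto
  have "\<bar>A\<bar> \<le> h / (R - r)" unfolding A_def
    using abs_arctan_divide_sub_le[of "R - Re z" d] le[of "R - Re z"] x R d
    by (smt (verit, best))
  moreover have "\<bar>B\<bar> \<le> h / (R - r)" unfolding B_def
    using abs_arctan_divide_sub_le[of "R + Re z" d] le[of "R + Re z"] x R d
    by (smt (verit, best))
  ultimately have AB: "\<bar>A + B\<bar> \<le> 2 * h / (R - r)" by linarith
  have "(\<integral>u. indicator {-R..R} u * winding_kernel z z' u v \<partial>lborel) + Re z' * pi * sgn (Im z - v)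
     = Im z' * l - Re z' * (A + B)"
    using x R by (subst integral_winding_kernel_line)
      (auto simp: v d_def[symmetric] l_def A_def B_def field_simps)
  also have "\<bar>\<dots>\<bar> \<le> \<bar>Im z'\<bar> * \<bar>l\<bar> + \<bar>Re z'\<bar> * \<bar>A + B\<bar>"
    unfolding abs_mult[symmetric] by (rule abs_triangle_ineq4)
  also have "\<dots> \<le> norm z' * ln ((R + r) / (R - r)) + norm z' * (2 * h / (R - r))"
    using l AB abs_Im_le_cmod abs_Re_le_cmod by (intro add_mono mult_mono) auto
  finally show ?thesis by (simp add: algebra_simps)
qed

text \<open>Off the null set \<open>v = y\<close> the integrand is the difference of the indicators
  of \<open>{-V..y}\<close> and \<open>{y..V}\<close>, of lengths \<open>V + y\<close> and
  \<open>V - y\<close>. With \<open>y = Im z\<close> this turns the sign term of the line estimate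
  into the factor \<open>Im z\<close>.\<close>

lemma integral_sgn_interval:
  fixes y V :: real
  assumes "\<bar>y\<bar> \<le> V"
  shows "integrable lborel (\<lambda>v. indicator {-V..V} v * sgn (y - v))"
    and "(\<integral>v. indicator {-V..V} v * sgn (y - v) \<partial>lborel) = 2 * y"
proof -
  have ae: "AE v in lborel. indicator {-V..V} v * sgn (y - v) = indicator {-V..y} v - (indicator {y..V} v :: real)"
    using AE_lborel_singleton[of y] by eventually_elim (use assms in \<open>auto simp: indicator_def sgn_if\<close>)
  have "integrable lborel (\<lambda>v. indicator {-V..y} v - (indicator {y..V} v :: real))"
    by (intro Bochner_Integration.integrable_diff) (auto simp: integrable_indicator_iff emeasure_lborel_Icc_eq)
  then show "integrable lborel (\<lambda>v. indicator {-V..V} v * sgn (y - v))"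
    by (subst integrable_cong_AE[OF _ _ ae]) auto
  show "(\<integral>v. indicator {-V..V} v * sgn (y - v) \<partial>lborel) = 2 * y"
    using assms by (subst integral_cong_AE[OF _ _ ae]) auto
qed

section \<open>Integration of the kernel over the whole rectangle\<close>

lemma measurable_winding_kernel [measurable]:
  assumes [measurable]: "f \<in> borel_measurable M" "f' \<in> borel_measurable M"
    "g \<in> borel_measurable M" "h \<in> borel_measurable M"
  shows "(\<lambda>x. winding_kernel (f x) (f' x) (g x) (h x)) \<in> borel_measurable M"
  unfolding winding_kernel_def by measurable

lemma nn_integral_lborel_real_prod:
  fixes f :: "real \<times> real \<Rightarrow> ennreal"
  assumes [measurable]: "f \<in> borel_measurable borel"
  shows "(\<integral>\<^sup>+w. f w \<partial>lborel) = (\<integral>\<^sup>+v. \<integral>\<^sup>+u. f (u, v) \<partial>lborel \<partial>lborel)"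
  using lborel_pair.nn_integral_snd[of f] by (simp add: lborel_prod)

lemma measurable_winding_kernel_box [measurable]:
  "(\<lambda>w. indicator ({-R..R} \<times> {-r..r}) w * winding_kernel z z' (fst w) (snd w)) \<in> borel_measurable borel"
  unfolding borel_prod[symmetric] by measurable

text \<open>Tonelli applied to the product bound on the kernel. The estimate depends on the curve
  point only through \<open>norm z'\<close>, which later yields joint integrability in the parameter
  and the plane.\<close>

lemma nn_integral_winding_kernel_box_le:
  assumes z: "\<bar>Re z\<bar> \<le> R" "\<bar>Im z\<bar> \<le> r"
  shows "(\<integral>\<^sup>+w. ennreal (norm (indicator ({-R..R} \<times> {-r..r}) w * winding_kernel z z' (fst w) (snd w))) \<partial>lborel)
     \<le> ennreal (norm z' * (4 * sqrt (2 * R)) * (4 * sqrt (2 * r)))" (is "?I \<le> _")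
proof -
  have Rr: "R \<ge> 0" "r \<ge> 0" using z by auto
  have "?I = (\<integral>\<^sup>+v. \<integral>\<^sup>+u. ennreal (norm (indicator ({-R..R} \<times> {-r..r}) (u, v) * winding_kernel z z' u v)) \<partial>lborel \<partial>lborel)"
    by (subst nn_integral_lborel_real_prod) (simp_all add: measurable_winding_kernel_box)
  also have "\<dots> \<le> (\<integral>\<^sup>+v. ennreal (norm z' * (4 * sqrt (2 * R))) * ennreal (indicator {-r..r} v / sqrt \<bar>Im z - v\<bar>) \<partial>lborel)"
  proof (rule nn_integral_mono_AE, use AE_lborel_singleton[of "Im z"] in eventually_elim)
    fix v assume v: "v \<noteq> Im z"
    have "(\<integral>\<^sup>+u. ennreal (norm (indicator ({-R..R} \<times> {-r..r}) (u, v) * winding_kernel z z' u v)) \<partial>lborel)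
       \<le> (\<integral>\<^sup>+u. ennreal (norm z' * (indicator {-r..r} v / sqrt \<bar>Im z - v\<bar>)) * ennreal (indicator {-R..R} u / sqrt \<bar>Re z - u\<bar>) \<partial>lborel)"
    proof (rule nn_integral_mono_AE, use AE_lborel_singleton[of "Re z"] in eventually_elim)
      fix u assume u: "u \<noteq> Re z"
      have "norm (indicator ({-R..R} \<times> {-r..r}) (u, v) * winding_kernel z z' u v)
         \<le> (norm z' * (indicator {-r..r} v / sqrt \<bar>Im z - v\<bar>)) * (indicator {-R..R} u / sqrt \<bar>Re z - u\<bar>)"
        using abs_winding_kernel_le[OF u v, of z']
        by (cases "u \<in> {-R..R}"; cases "v \<in> {-r..r}") (simp_all add: indicator_times mult.commute)
      then show "ennreal (norm (indicator ({-R..R} \<times> {-r..r}) (u, v) * winding_kernel z z' u v))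
         \<le> ennreal (norm z' * (indicator {-r..r} v / sqrt \<bar>Im z - v\<bar>)) * ennreal (indicator {-R..R} u / sqrt \<bar>Re z - u\<bar>)"
        by (subst ennreal_mult[symmetric]) (simp_all add: ennreal_leI)
    qed
    also have "\<dots> = ennreal (norm z' * (indicator {-r..r} v / sqrt \<bar>Im z - v\<bar>)) *
        (\<integral>\<^sup>+u. ennreal (indicator {-R..R} u / sqrt \<bar>Re z - u\<bar>) \<partial>lborel)"
      by (rule nn_integral_cmult) auto
    also have "\<dots> \<le> ennreal (norm z' * (indicator {-r..r} v / sqrt \<bar>Im z - v\<bar>)) * ennreal (4 * sqrt (2 * R))"
      by (intro mult_left_mono nn_integral_inverse_sqrt_abs_le z) auto
    also have "\<dots> = ennreal (norm z' * (4 * sqrt (2 * R))) * ennreal (indicator {-r..r} v / sqrt \<bar>Im z - v\<bar>)"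
      using Rr by (simp add: ennreal_mult[symmetric] mult_ac)
    finally show "(\<integral>\<^sup>+u. ennreal (norm (indicator ({-R..R} \<times> {-r..r}) (u, v) * winding_kernel z z' u v)) \<partial>lborel)
       \<le> ennreal (norm z' * (4 * sqrt (2 * R))) * ennreal (indicator {-r..r} v / sqrt \<bar>Im z - v\<bar>)" .
  qed
  also have "\<dots> = ennreal (norm z' * (4 * sqrt (2 * R))) * (\<integral>\<^sup>+v. ennreal (indicator {-r..r} v / sqrt \<bar>Im z - v\<bar>) \<partial>lborel)"
    by (rule nn_integral_cmult) auto
  also have "\<dots> \<le> ennreal (norm z' * (4 * sqrt (2 * R))) * ennreal (4 * sqrt (2 * r))"
    by (intro mult_left_mono nn_integral_inverse_sqrt_abs_le z) auto
  also have "\<dots> = ennreal (norm z' * (4 * sqrt (2 * R)) * (4 * sqrt (2 * r)))"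
    using Rr by (subst ennreal_mult[symmetric]) auto
  finally show ?thesis .
qed

lemma integrable_winding_kernel_box:
  assumes z: "\<bar>Re z\<bar> \<le> R" "\<bar>Im z\<bar> \<le> r"
  shows "integrable lborel (\<lambda>w. indicator ({-R..R} \<times> {-r..r}) w * winding_kernel z z' (fst w) (snd w))"
proof (rule integrableI_bounded)
  show "(\<integral>\<^sup>+w. ennreal (norm (indicator ({-R..R} \<times> {-r..r}) w * winding_kernel z z' (fst w) (snd w))) \<partial>lborel) < \<infinity>"
    using le_less_trans[OF nn_integral_winding_kernel_box_le[OF assms] ennreal_less_top] by simp
qed (simp add: measurable_winding_kernel_box)

text \<open>Integrate the line estimate with \<open>h = 2 * r\<close> over the height; the sign term
  contributes \<open>2 * Im z\<close>. Only the width of the rectangle grows, so the error still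
  vanishes in the limit.\<close>

lemma integral_winding_kernel_box_approx:
  assumes z: "\<bar>Re z\<bar> \<le> r" "\<bar>Im z\<bar> \<le> r" and R: "r < R"
  shows "\<bar>(\<integral>w. indicator ({-R..R} \<times> {-r..r}) w * winding_kernel z z' (fst w) (snd w) \<partial>lborel)
             + 2 * pi * (Re z' * Im z)\<bar>
     \<le> 2 * r * (norm z' * (ln ((R + r) / (R - r)) + 4 * r / (R - r)))" (is "_ \<le> 2 * r * ?e")
proof -
  have box: "(\<lambda>w. indicator ({-R..R} \<times> {-r..r}) w * winding_kernel z z' (fst w) (snd w))
     = (\<lambda>(u, v). indicator {-r..r} v * (indicator {-R..R} u * winding_kernel z z' u v))"
    by (auto simp: fun_eq_iff indicator_def)
  have int: "integrable (lborel \<Otimes>\<^sub>M lborel) (\<lambda>(u,v). indicator {-r..r} v * (indicator {-R..R} u * winding_kernel z z' u v))"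
    using integrable_winding_kernel_box[of z R r z'] z R
    unfolding box by (simp add: lborel_prod)
  define I where "I v = (\<integral>u. indicator {-R..R} u * winding_kernel z z' u v \<partial>lborel)" for v
  have intI: "integrable lborel (\<lambda>v. indicator {-r..r} v * I v)"
    using lborel_pair.integrable_snd[OF int] by (simp add: I_def)
  have eq: "(\<integral>w. indicator ({-R..R} \<times> {-r..r}) w * winding_kernel z z' (fst w) (snd w) \<partial>lborel)
      = (\<integral>v. indicator {-r..r} v * I v \<partial>lborel)"
    using lborel_pair.integral_snd[OF int] unfolding box by (simp add: lborel_prod I_def)
  note sgn = integral_sgn_interval[OF z(2)]
  have intS: "integrable lborel (\<lambda>v. Re z' * pi * (indicator {-r..r} v * sgn (Im z - v)))"
    using sgn(1) by (rule integrable_mult_right)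
  have eq2: "(\<integral>v. indicator {-r..r} v * I v \<partial>lborel) + 2 * pi * (Re z' * Im z)
      = (\<integral>v. indicator {-r..r} v * I v + Re z' * pi * (indicator {-r..r} v * sgn (Im z - v)) \<partial>lborel)"
    using intI intS sgn(2) by simp
  have "\<bar>\<integral>v. indicator {-r..r} v * I v + Re z' * pi * (indicator {-r..r} v * sgn (Im z - v)) \<partial>lborel\<bar>
      \<le> (\<integral>v. norm (indicator {-r..r} v * I v + Re z' * pi * (indicator {-r..r} v * sgn (Im z - v))) \<partial>lborel)"
    using integral_norm_bound[of lborel "\<lambda>v. indicator {-r..r} v * I v + Re z' * pi * (indicator {-r..r} v * sgn (Im z - v))"] by simp
  also have "\<dots> \<le> (\<integral>v. indicator {-r..r} v * ?e \<partial>lborel)"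
  proof (rule integral_mono_AE)
    show "integrable lborel (\<lambda>v. norm (indicator {-r..r} v * I v + Re z' * pi * (indicator {-r..r} v * sgn (Im z - v))))"
      using intI intS by (intro integrable_norm Bochner_Integration.integrable_add)
    show "integrable lborel (\<lambda>v. indicator {-r..r} v * ?e)"
      by (intro integrable_mult_left) (auto simp: integrable_indicator_iff emeasure_lborel_Icc_eq)
    show "AE v in lborel. norm (indicator {-r..r} v * I v + Re z' * pi * (indicator {-r..r} v * sgn (Im z - v))) \<le> indicator {-r..r} v * ?e"
      using AE_lborel_singleton[of "Im z"]
    proof eventually_elim
      fix v assume v: "v \<noteq> Im z"
      show "norm (indicator {-r..r} v * I v + Re z' * pi * (indicator {-r..r} v * sgn (Im z - v))) \<le> indicator {-r..r} v * ?e"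
      proof (cases "v \<in> {-r..r}")
        case True
        then have "\<bar>Im z - v\<bar> \<le> 2 * r" using z by auto
        from integral_winding_kernel_line_approx[OF v this z(1) R, of z'] True
        show ?thesis by (simp add: I_def)
      qed simp
    qed
  qed
  also have "\<dots> = 2 * r * ?e" using z by simp
  finally show ?thesis unfolding eq eq2 .
qed

section \<open>Winding numbers of continuously differentiable curves\<close>

text \<open>The derivative is required on the whole line, so one-sided derivatives at the ends of
  \<open>{0..1}\<close> never arise; path notions use only the restriction to
  \<open>{0..1}\<close>.\<close>

locale C1_curve =
  fixes \<gamma> \<gamma>' :: "real \<Rightarrow> complex"
  assumes deriv: "(\<gamma> has_vector_derivative \<gamma>' t) (at t)"
    and continuous_deriv: "continuous_on UNIV \<gamma>'"
begin

lemma continuous: "continuous_on S \<gamma>"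
  by (meson continuous_at_imp_continuous_on deriv has_vector_derivative_continuous)

lemma vector_derivative_eq: "vector_derivative \<gamma> (at t) = \<gamma>' t"
  by (rule vector_derivative_at) (rule deriv)

lemma valid_path: "valid_path \<gamma>"
  unfolding valid_path_def
  by (intro C1_differentiable_imp_piecewise)
    (auto simp: C1_differentiable_on_def intro!: exI[of _ \<gamma>'] deriv
       intro: continuous_on_subset[OF continuous_deriv])

text \<open>The imaginary part of the contour integral of \<open>1 / (z - w)\<close>, which is
  \<open>2 * pi * \<i>\<close> times the winding number.\<close>

lemma winding_number_has_integral:
  assumes "w \<notin> path_image \<gamma>"
  shows "((\<lambda>t. Im (\<gamma>' t / (\<gamma> t - w))) has_integral 2 * pi * Re (winding_number \<gamma> w)) {0..1}"
proof -
  have "((\<lambda>t. 1 / (\<gamma> t - w) * \<gamma>' t) has_integral 2 * pi * \<i> * winding_number \<gamma> w) {0..1}"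
    using has_contour_integral_winding_number[OF valid_path assms]
    unfolding has_contour_integral vector_derivative_eq .
  from has_integral_linear[OF this bounded_linear_Im] show ?thesis
    by (simp add: o_def)
qed

text \<open>Crossing the curve from right to left at \<open>\<gamma> t\<^sub>0\<close> cannot lower the winding number: after
  dividing by the tangent \<open>T\<close>, the difference of the two Cauchy kernels is
  \<open>2\<epsilon> q / (z\<^sup>2 + \<epsilon>\<^sup>2)\<close> with \<open>q \<approx> 1\<close> and \<open>z \<approx> t - t\<^sub>0\<close>, whose real part is nonnegative near
  \<open>t\<^sub>0\<close>, and the rest of the curve contributes \<open>O(\<epsilon>)\<close>.\<close>

lemma winding_number_jump_gt:
  assumes t0: "0 < t0" "t0 < 1" and T: "\<gamma>' t0 \<noteq> 0"
    and uniq: "\<And>t. t \<in> {0..1} \<Longrightarrow> \<gamma> t = \<gamma> t0 \<Longrightarrow> t = t0"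
    and ev: "\<forall>\<^sub>F e in at_right 0. \<gamma> t0 + of_real e * (\<i> * \<gamma>' t0) \<notin> path_image \<gamma> \<and>
                 \<gamma> t0 - of_real e * (\<i> * \<gamma>' t0) \<notin> path_image \<gamma>"
  shows "\<forall>\<^sub>F e in at_right 0.
     Re (winding_number \<gamma> (\<gamma> t0 + of_real e * (\<i> * \<gamma>' t0)))
      - Re (winding_number \<gamma> (\<gamma> t0 - of_real e * (\<i> * \<gamma>' t0))) > -1"
proof -
  \<comment> \<open>Moving \<open>\<gamma> t0\<close> to 0 and dividing by \<open>T\<close> gives a
    curve \<open>z\<close> with velocity \<open>q\<close> that passes 0 with velocity 1. The two
    test points become \<open>\<i> * e\<close> and \<open>- \<i> * e\<close>.\<close>
  define T where "T = \<gamma>' t0"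
  define q where "q t = \<gamma>' t / T" for t
  define z where "z t = (\<gamma> t - \<gamma> t0) / T" for t
  have T0: "T \<noteq> 0" using T by (simp add: T_def)
  have zd: "(z has_vector_derivative q t) (at t)" for t
    unfolding z_def q_def using T0
    by (auto intro!: derivative_eq_intros deriv)
  have z0: "z t0 = 0" and q0: "q t0 = 1" using T0 by (auto simp: z_def q_def T_def)
  have qc: "continuous_on UNIV q" unfolding q_def using T0
    by (intro continuous_intros continuous_deriv) auto
  have zc: "continuous_on S z" for S unfolding z_def using T0
    by (intro continuous_intros continuous) auto
  have "isCont q t0" using qc by (simp add: continuous_on_eq_continuous_at)
  then obtain d where d: "d > 0" "\<And>t. \<bar>t - t0\<bar> < d \<Longrightarrow> norm (q t - 1) < 1/10"
    unfolding continuous_at_eps_delta dist_norm using q0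
    by (metis real_norm_def zero_less_divide_1_iff zero_less_numeral)
  \<comment> \<open>The mean value inequality for \<open>z s - s\<close>, whose derivative
    \<open>q s - 1\<close> has norm at most 1/10 on the interval.\<close>
  have near: "norm (z t - of_real (t - t0)) \<le> 1/10 * \<bar>t - t0\<bar>" if "\<bar>t - t0\<bar> < d" for t
  proof -
    have "norm ((\<lambda>s. z s - of_real s) t - (\<lambda>s. z s - of_real s) t0) \<le> 1/10 * norm (t - t0)"
    proof (rule differentiable_bound[where S="{t0-d<..<t0+d}" and f'="\<lambda>s h. h *\<^sub>R (q s - 1)"])
      fix x assume x: "x \<in> {t0-d<..<t0+d}"
      have "((\<lambda>s. z s - of_real s) has_vector_derivative q x - 1) (at x)"
        by (auto intro!: derivative_eq_intros zd)
      then show "((\<lambda>s. z s - of_real s) has_derivative (\<lambda>h. h *\<^sub>R (q x - 1))) (at x within {t0-d<..<t0+d})"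
        unfolding has_vector_derivative_def by (rule has_derivative_at_withinI)
      have "\<bar>x - t0\<bar> < d" using x by auto
      then have le: "norm (q x - 1) \<le> 1/10" using d(2)[of x] by simp
      show "onorm (\<lambda>h. h *\<^sub>R (q x - 1)) \<le> 1/10"
      proof (rule onorm_le)
        fix h :: real
        show "norm (h *\<^sub>R (q x - 1)) \<le> 1/10 * norm h"
          using mult_left_mono[OF le abs_ge_zero[of h]] by simp
      qed
    qed (use that d(1) in auto)
    then show ?thesis by (simp add: z0 algebra_simps)
  qed
  \<comment> \<open>The sign is that of the real part of \<open>q t\<close> times the conjugate of
    the denominator. Its main term is \<open>r = \<tau>^2 + e^2\<close>; the three errors are at
    most \<open>21/100 * \<tau>^2\<close>, \<open>1/10 * r\<close> and
    \<open>21/1000 * \<tau>^2\<close>, together at most \<open>r\<close>.\<close>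
  have near_nonneg: "Re (q t / ((z t)\<^sup>2 + of_real (e\<^sup>2))) \<ge> 0" if t: "\<bar>t - t0\<bar> < d" for t e :: real
  proof -
    define \<tau> where "\<tau> = t - t0"
    define w where "w = (z t)\<^sup>2 - of_real (\<tau>\<^sup>2)"
    have n: "norm (z t - of_real \<tau>) \<le> 1/10 * \<bar>\<tau>\<bar>" using near[OF t] by (simp add: \<tau>_def)
    have "norm (z t + of_real \<tau>) \<le> norm (z t - of_real \<tau>) + norm (2 * of_real \<tau> :: complex)"
      using norm_triangle_ineq[of "z t - of_real \<tau>" "2 * of_real \<tau>"] by (simp add: add.commute)
    also have "\<dots> \<le> 21/10 * \<bar>\<tau>\<bar>" using n by (simp add: norm_mult)
    finally have "norm (z t - of_real \<tau>) * norm (z t + of_real \<tau>) \<le> (1/10 * \<bar>\<tau>\<bar>) * (21/10 * \<bar>\<tau>\<bar>)"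
      using n by (intro mult_mono) auto
    moreover have "w = (z t - of_real \<tau>) * (z t + of_real \<tau>)"
      by (simp add: w_def algebra_simps power2_eq_square)
    ultimately have nw: "norm w \<le> 21/100 * \<tau>\<^sup>2"
      by (simp add: norm_mult power2_eq_square abs_mult[symmetric])
    define p where "p = q t - 1"
    have np: "norm p \<le> 1/10" using d(2)[OF t] by (simp add: p_def)
    define r where "r = \<tau>\<^sup>2 + e\<^sup>2"
    have r: "r \<ge> 0" "\<tau>\<^sup>2 \<le> r" by (auto simp: r_def)
    have "norm (p * cnj w) \<le> 1/10 * (21/100 * \<tau>\<^sup>2)"
      unfolding norm_mult using np nw by (intro mult_mono) auto
    then have a: "\<bar>Re (p * cnj w)\<bar> \<le> 21/1000 * \<tau>\<^sup>2"
      using abs_Re_le_cmod[of "p * cnj w"] by linarith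
    have b: "\<bar>Re p * r\<bar> \<le> 1/10 * r"
      using np abs_Re_le_cmod[of p] r unfolding abs_mult by (intro mult_mono) auto
    have c: "\<bar>Re w\<bar> \<le> 21/100 * \<tau>\<^sup>2" using nw abs_Re_le_cmod[of w] by linarith
    have eq: "q t * cnj ((z t)\<^sup>2 + of_real (e\<^sup>2)) = of_real r + cnj w + p * of_real r + p * cnj w"
      by (simp add: p_def w_def r_def algebra_simps)
    have "0 \<le> r + Re w + Re p * r + Re (p * cnj w)"
      using a b c r by linarith
    also have "\<dots> = Re (q t * cnj ((z t)\<^sup>2 + of_real (e\<^sup>2)))"
      unfolding eq by simp
    finally show ?thesis
      by (simp add: complex_div_cnj[of "q t"] del: complex_cnj_add complex_cnj_power)
  qed
  \<comment> \<open>On the compact remainder \<open>A\<close> the curve does not return to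
    \<open>\<gamma> t0\<close>, so \<open>z\<close> keeps a distance \<open>m\<close> from
    0.\<close>
  define A where "A = {0..1} - {t0-d<..<t0+d}"
  have "compact A" unfolding A_def by (intro compact_diff) auto
  then obtain m where m: "m > 0" "\<And>t. t \<in> A \<Longrightarrow> m \<le> norm (z t)"
  proof -
    have "compact (z ` A)" using \<open>compact A\<close> zc by (rule compact_continuous_image[rotated])
    moreover have "0 \<notin> z ` A"
    proof
      assume "0 \<in> z ` A"
      then obtain t where "t \<in> A" "z t = 0" by auto
      then have "t = t0" using T0 uniq[of t] by (auto simp: z_def A_def)
      then show False using \<open>t \<in> A\<close> d(1) by (auto simp: A_def)
    qed
    ultimately obtain m where "m > 0" "\<And>x. x \<in> z ` A \<Longrightarrow> m \<le> dist 0 x"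
      using separate_point_closed[OF compact_imp_closed, of "z ` A" 0] by metis
    then show ?thesis using that by auto
  qed
  obtain B where B: "B > 0" "\<And>t. t \<in> {0..1} \<Longrightarrow> norm (q t) \<le> B"
  proof -
    have "compact (q ` {0..1})" by (intro compact_continuous_image continuous_on_subset[OF qc]) auto
    then show ?thesis using that unfolding compact_eq_bounded_closed bounded_pos by auto
  qed
  have far: "Re (q t / ((z t)\<^sup>2 + of_real (e\<^sup>2))) \<ge> - (2 * B / m\<^sup>2)"
    if t: "t \<in> A" and e: "e\<^sup>2 \<le> m\<^sup>2 / 2" for t e :: real
  proof -
    have "m\<^sup>2 \<le> norm ((z t)\<^sup>2)" using m(2)[OF t] m(1) by (simp add: norm_power)
    moreover have "norm ((z t)\<^sup>2) \<le> norm ((z t)\<^sup>2 + of_real (e\<^sup>2)) + e\<^sup>2"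
      using norm_triangle_ineq4[of "(z t)\<^sup>2 + of_real (e\<^sup>2)" "of_real (e\<^sup>2)"] by (simp add: norm_power)
    ultimately have "m\<^sup>2 / 2 \<le> norm ((z t)\<^sup>2 + of_real (e\<^sup>2))" using e by linarith
    then have "norm (q t / ((z t)\<^sup>2 + of_real (e\<^sup>2))) \<le> B / (m\<^sup>2 / 2)"
      unfolding norm_divide using B t m(1) by (intro frac_le) (auto simp: A_def)
    then show ?thesis using abs_Re_le_cmod[of "q t / ((z t)\<^sup>2 + of_real (e\<^sup>2))"] by (simp add: mult.commute)
  qed
  \<comment> \<open>The integrand is nonnegative near \<open>t0\<close> and at least
    \<open>- (2 * e * (2 * B / m^2))\<close> on \<open>A\<close>. Over a parameter interval of
    length 1 the integral therefore exceeds \<open>- 2 * pi\<close>.\<close>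
  have main: "- 1 < Re (winding_number \<gamma> (\<gamma> t0 + of_real e * (\<i> * \<gamma>' t0)))
      - Re (winding_number \<gamma> (\<gamma> t0 - of_real e * (\<i> * \<gamma>' t0)))"
    if e: "0 < e" "e\<^sup>2 \<le> m\<^sup>2/2" "2 * e * (2 * B / m\<^sup>2) < 2 * pi"
      and off: "\<gamma> t0 + of_real e * (\<i> * \<gamma>' t0) \<notin> path_image \<gamma>"
       "\<gamma> t0 - of_real e * (\<i> * \<gamma>' t0) \<notin> path_image \<gamma>" for e :: real
  proof -
    define w1 where "w1 = \<gamma> t0 + of_real e * (\<i> * \<gamma>' t0)"
    define w2 where "w2 = \<gamma> t0 - of_real e * (\<i> * \<gamma>' t0)"
    have I: "((\<lambda>t. Im (\<gamma>' t / (\<gamma> t - w1)) - Im (\<gamma>' t / (\<gamma> t - w2))) has_integral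
         2 * pi * Re (winding_number \<gamma> w1) - 2 * pi * Re (winding_number \<gamma> w2)) {0..1}"
      using off by (intro has_integral_diff winding_number_has_integral) (auto simp: w1_def w2_def)
    have J: "((\<lambda>t. - (2 * e * (2 * B / m\<^sup>2))) has_integral - (2 * e * (2 * B / m\<^sup>2))) {0..1::real}"
      using has_integral_const_real[of "- (2 * e * (2 * B / m\<^sup>2))" 0 1] by simp
    have "- (2 * e * (2 * B / m\<^sup>2)) \<le> 2 * pi * Re (winding_number \<gamma> w1) - 2 * pi * Re (winding_number \<gamma> w2)"
    proof (rule has_integral_le[OF J I])
      fix t :: real assume t: "t \<in> {0..1}"
      have n1: "\<gamma> t - w1 \<noteq> 0" "\<gamma> t - w2 \<noteq> 0" using off imageI[OF t, of \<gamma>]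
        unfolding w1_def w2_def path_image_def by force+
      have f1: "\<gamma> t - w1 = T * (z t - of_real e * \<i>)" "\<gamma> t - w2 = T * (z t + of_real e * \<i>)"
        using T0 by (auto simp: w1_def w2_def z_def T_def field_simps)
      then have nz: "z t - of_real e * \<i> \<noteq> 0" "z t + of_real e * \<i> \<noteq> 0" using n1 by auto
      have "\<gamma>' t / (\<gamma> t - w1) - \<gamma>' t / (\<gamma> t - w2) = q t / (z t - of_real e * \<i>) - q t / (z t + of_real e * \<i>)"
        unfolding f1 q_def by simp
      \<comment> \<open>The two simple poles combine, and the factor \<open>\<i>\<close> turns the
        imaginary part into the real part estimated above.\<close>
      also have "\<dots> = of_real (2 * e) * (\<i> * (q t / ((z t - of_real e * \<i>) * (z t + of_real e * \<i>))))"
        using nz by (simp add: field_simps)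
      also have "(z t - of_real e * \<i>) * (z t + of_real e * \<i>) = (z t)\<^sup>2 + of_real (e\<^sup>2)"
        by (simp add: algebra_simps power2_eq_square)
      finally have "Im (\<gamma>' t / (\<gamma> t - w1)) - Im (\<gamma>' t / (\<gamma> t - w2))
         = Im (of_real (2 * e) * (\<i> * (q t / ((z t)\<^sup>2 + of_real (e\<^sup>2)))))"
        by (metis minus_complex.sel(2))
      also have "\<dots> = 2 * e * Re (q t / ((z t)\<^sup>2 + of_real (e\<^sup>2)))"
        by (simp only: Im_complex_of_real Re_complex_of_real times_complex.sel Re_i_times Im_i_times) simp
      also have "\<dots> \<ge> 2 * e * (- (2 * B / m\<^sup>2))"
      proof -
        have "Re (q t / ((z t)\<^sup>2 + of_real (e\<^sup>2))) \<ge> - (2 * B / m\<^sup>2)"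
        proof (cases "t \<in> A")
          case False
          then have "0 \<le> Re (q t / ((z t)\<^sup>2 + of_real (e\<^sup>2)))"
            using t by (intro near_nonneg) (auto simp: A_def)
          moreover have "0 \<le> 2 * B / m\<^sup>2" using B by simp
          ultimately show ?thesis by linarith
        qed (use far e in auto)
        then show ?thesis using e(1) by (intro mult_left_mono) auto
      qed
      finally show "- (2 * e * (2 * B / m\<^sup>2)) \<le> Im (\<gamma>' t / (\<gamma> t - w1)) - Im (\<gamma>' t / (\<gamma> t - w2))"
        by simp
    qed
    then have "2 * pi * (Re (winding_number \<gamma> w1) - Re (winding_number \<gamma> w2)) > 2 * pi * (-1)"
      using e(3) by (simp add: algebra_simps)
    then show ?thesis unfolding w1_def w2_def by (subst (asm) mult_less_cancel_left_pos) auto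
  qed
  have "((\<lambda>e::real. e\<^sup>2) \<longlongrightarrow> 0\<^sup>2) (at_right 0)" by (intro tendsto_intros)
  then have "\<forall>\<^sub>F e::real in at_right 0. e\<^sup>2 < m\<^sup>2/2" by (rule order_tendstoD) (use m in auto)
  moreover have "((\<lambda>e::real. 2 * e * (2 * B / m\<^sup>2)) \<longlongrightarrow> 2 * 0 * (2 * B / m\<^sup>2)) (at_right 0)" by (intro tendsto_intros)
  then have "\<forall>\<^sub>F e::real in at_right 0. 2 * e * (2 * B / m\<^sup>2) < 2 * pi" by (rule order_tendstoD) auto
  moreover have "\<forall>\<^sub>F e::real in at_right 0. 0 < e" by (simp add: eventually_at_right_less)
  ultimately show ?thesis using ev
    by eventually_elim (intro main, auto)
qed

section \<open>The enclosed area as an integral of the winding number\<close>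

lemma measurable_curve [measurable]: "\<gamma> \<in> borel_measurable borel" "\<gamma>' \<in> borel_measurable borel"
  using continuous continuous_deriv by (auto intro: borel_measurable_continuous_onI)

text \<open>A differentiable image of an interval in the plane is negligible. Hence values on the
  curve itself, where the winding number carries no information, do not affect the integral.\<close>

lemma null_set_trace: "{w. Complex (fst w) (snd w) \<in> path_image \<gamma>} \<in> null_sets lebesgue"
proof -
  let ?g = "\<lambda>t. (Re (\<gamma> t), Im (\<gamma> t))"
  have "?g differentiable_on {0..1}"
    unfolding differentiable_on_def
  proof
    fix t
    have "((\<lambda>t. (Re (\<gamma> t), Im (\<gamma> t))) has_vector_derivative (Re (\<gamma>' t), Im (\<gamma>' t))) (at t within {0..1})"
      by (intro has_vector_derivative_Pair bounded_linear.has_vector_derivative[OF bounded_linear_Re]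
          bounded_linear.has_vector_derivative[OF bounded_linear_Im]
          has_vector_derivative_at_within[OF deriv])
    then show "?g differentiable (at t within {0..1})"
      by (auto simp: differentiable_def has_vector_derivative_def)
  qed
  then have "negligible (?g ` {0..1})"
    by (intro negligible_differentiable_image_lowdim) auto
  moreover have "?g ` {0..1} = {w. Complex (fst w) (snd w) \<in> path_image \<gamma>}"
    by (force simp: path_image_def image_iff complex_eq_iff)
  ultimately show ?thesis by (simp add: negligible_iff_null_sets)
qed

text \<open>Fubini exchanges the integral over the rectangle with the one along the curve. The
  function \<open>f\<close> is a measurable representative of the winding number, so the
  measurability of \<open>winding_number\<close> itself need not be discussed.\<close>

lemma integral_winding_number_box_approx:
  assumes r: "\<And>t. t \<in> {0..1} \<Longrightarrow> \<bar>Re (\<gamma> t)\<bar> \<le> r" "\<And>t. t \<in> {0..1} \<Longrightarrow> \<bar>Im (\<gamma> t)\<bar> \<le> r"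
    and B: "\<And>t. t \<in> {0..1} \<Longrightarrow> norm (\<gamma>' t) \<le> B" and R: "r < R"
    and f: "f \<in> borel_measurable borel"
      "\<And>w. Complex (fst w) (snd w) \<notin> path_image \<gamma> \<Longrightarrow> f w = Re (winding_number \<gamma> (Complex (fst w) (snd w)))"
  shows "\<bar>(\<integral>w. indicator ({-R..R} \<times> {-r..r}) w * (2 * pi * f w) \<partial>lborel)
            + 2 * pi * integral {0..1} (\<lambda>t. Re (\<gamma>' t) * Im (\<gamma> t))\<bar>
         \<le> 2 * r * (B * (ln ((R + r) / (R - r)) + 4 * r / (R - r)))"
proof -
  let ?Q = "{-R..R} \<times> {-r..r}"
  have r0: "r \<ge> 0" using r(1)[of 0] by auto
  define e where "e = ln ((R + r) / (R - r)) + 4 * r / (R - r)"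
  have e0: "e \<ge> 0" unfolding e_def using r0 R by (intro add_nonneg_nonneg ln_ge_zero) auto
  define F where "F t w = indicator {0..1} t * (indicator ?Q w * winding_kernel (\<gamma> t) (\<gamma>' t) (fst w) (snd w))"
    for t and w :: "real \<times> real"
  have Fm[measurable]: "(\<lambda>(t, w). F t w) \<in> borel_measurable (lborel \<Otimes>\<^sub>M lborel)"
  proof -
    have [measurable]: "?Q \<in> sets (borel \<Otimes>\<^sub>M borel)" by measurable
    show ?thesis unfolding F_def lborel_prod[symmetric] by measurable
  qed
  have pair: "pair_sigma_finite (lborel :: real measure) (lborel :: (real \<times> real) measure)" ..
  \<comment> \<open>The kernel is singular where \<open>w\<close> lies on the curve, but its
    rectangle integrals are bounded uniformly in \<open>t\<close> because
    \<open>norm (\<gamma>' t) \<le> B\<close>.\<close>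
  have int: "integrable (lborel \<Otimes>\<^sub>M lborel) (\<lambda>(t, w). F t w)"
  proof (rule integrableI_bounded[OF Fm])
    have "(\<integral>\<^sup>+ p. ennreal (norm (case p of (t, w) \<Rightarrow> F t w)) \<partial>(lborel \<Otimes>\<^sub>M lborel))
        = (\<integral>\<^sup>+ t. \<integral>\<^sup>+w. ennreal (norm (F t w)) \<partial>lborel \<partial>lborel)"
      by (subst lborel.nn_integral_fst[symmetric]) auto
    also have "\<dots> \<le> (\<integral>\<^sup>+ t. ennreal (B * (4 * sqrt (2 * R)) * (4 * sqrt (2 * r))) * indicator {0..1::real} t \<partial>lborel)"
    proof (rule nn_integral_mono)
      fix t :: real
      show "(\<integral>\<^sup>+w. ennreal (norm (F t w)) \<partial>lborel) \<le> ennreal (B * (4 * sqrt (2 * R)) * (4 * sqrt (2 * r))) * indicator {0..1} t"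
      proof (cases "t \<in> {0..1}")
        case True
        have "(\<integral>\<^sup>+w. ennreal (norm (F t w)) \<partial>lborel) \<le> ennreal (norm (\<gamma>' t) * (4 * sqrt (2 * R)) * (4 * sqrt (2 * r)))"
          unfolding F_def using True nn_integral_winding_kernel_box_le[of "\<gamma> t" R r "\<gamma>' t"] r[OF True] R by simp
        also have "\<dots> \<le> ennreal (B * (4 * sqrt (2 * R)) * (4 * sqrt (2 * r)))"
          using B[OF True] R r0 by (intro ennreal_leI mult_right_mono) auto
        finally show ?thesis using True by simp
      qed (simp add: F_def)
    qed
    also have "\<dots> < \<infinity>" by (simp add: nn_integral_cmult ennreal_mult_less_top)
    finally show "(\<integral>\<^sup>+ p. ennreal (norm (case p of (t, w) \<Rightarrow> F t w)) \<partial>(lborel \<Otimes>\<^sub>M lborel)) < \<infinity>" .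
  qed
  have swap: "(\<integral>w. (\<integral>t. F t w \<partial>lborel) \<partial>lborel) = (\<integral>t. (\<integral>w. F t w \<partial>lborel) \<partial>lborel)"
    using pair_sigma_finite.Fubini_integral[OF pair int] .
  have "(\<integral>w. indicator ?Q w * (2 * pi * f w) \<partial>lborel) = (\<integral>w. (\<integral>t. F t w \<partial>lborel) \<partial>lborel)"
  proof (rule integral_cong_AE)
    show "(\<lambda>w. indicator ?Q w * (2 * pi * f w)) \<in> borel_measurable lborel"
    proof -
      have "?Q \<in> sets borel" unfolding borel_prod[symmetric] by measurable
      then show ?thesis using f(1) by simp
    qed
    show "(\<lambda>w. \<integral>t. F t w \<partial>lborel) \<in> borel_measurable lborel"
      using Fm pair_sigma_finite.integrable_snd[OF pair int] by (auto dest: borel_measurable_integrable)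
    \<comment> \<open>Off the trace the kernel is continuous in \<open>t\<close>, so its Lebesgue
      integral over \<open>{0..1}\<close> agrees with the winding number integral.\<close>
    have "AE w in lebesgue. Complex (fst w) (snd w) \<notin> path_image \<gamma>"
      by (rule AE_I'[OF null_set_trace]) auto
    then have "AE w in lborel. Complex (fst w) (snd w) \<notin> path_image \<gamma>"
      by (simp add: AE_completion_iff)
    then show "AE w in lborel. indicator ?Q w * (2 * pi * f w) = (\<integral>t. F t w \<partial>lborel)"
    proof eventually_elim
      fix w :: "real \<times> real" assume w: "Complex (fst w) (snd w) \<notin> path_image \<gamma>"
      let ?k = "\<lambda>t. winding_kernel (\<gamma> t) (\<gamma>' t) (fst w) (snd w)"
      have "(?k has_integral 2 * pi * f w) {0..1}"
        using winding_number_has_integral[OF w] f(2)[OF w] by (simp add: winding_kernel_def)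
      moreover have "continuous_on {0..1} ?k"
        unfolding winding_kernel_def using w unfolding path_image_def
        by (intro continuous_intros continuous continuous_on_subset[OF continuous_deriv]) force+
      then have "set_integrable lborel {0..1} ?k" by (rule borel_integrable_atLeastAtMost')
      from set_borel_integral_eq_integral[OF this]
      have "(\<integral>t. indicator {0..1} t * ?k t \<partial>lborel) = integral {0..1} ?k"
        by (simp add: set_lebesgue_integral_def)
      ultimately have "(\<integral>t. indicator {0..1} t * ?k t \<partial>lborel) = 2 * pi * f w"
        by (simp add: integral_unique)
      then show "indicator ?Q w * (2 * pi * f w) = (\<integral>t. F t w \<partial>lborel)"
        unfolding F_def by (simp add: mult.left_commute[of "indicator {0..1} _"])
    qed
  qed
  also note swap
  finally have eq1: "(\<integral>w. indicator ?Q w * (2 * pi * f w) \<partial>lborel) = (\<integral>t. (\<integral>w. F t w \<partial>lborel) \<partial>lborel)" .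
  have cont: "continuous_on {0..1} (\<lambda>t. Re (\<gamma>' t) * Im (\<gamma> t))"
    by (intro continuous_intros continuous continuous_on_subset[OF continuous_deriv]) auto
  note si = borel_integrable_atLeastAtMost'[OF cont]
  have eq2: "integral {0..1} (\<lambda>t. Re (\<gamma>' t) * Im (\<gamma> t)) = (\<integral>t. indicator {0..1} t * (Re (\<gamma>' t) * Im (\<gamma> t)) \<partial>lborel)"
    using set_borel_integral_eq_integral[OF si] by (simp add: set_lebesgue_integral_def)
  have i1: "integrable lborel (\<lambda>t. \<integral>w. F t w \<partial>lborel)"
    using pair_sigma_finite.integrable_fst'[OF pair int] by simp
  have i2: "integrable lborel (\<lambda>t. 2 * pi * (indicator {0..1} t * (Re (\<gamma>' t) * Im (\<gamma> t))))"
    using si by (intro integrable_mult_right) (simp add: set_integrable_def)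
  have eq3: "(\<integral>t. (\<integral>w. F t w \<partial>lborel) \<partial>lborel) + 2 * pi * (\<integral>t. indicator {0..1} t * (Re (\<gamma>' t) * Im (\<gamma> t)) \<partial>lborel)
     = (\<integral>t. (\<integral>w. F t w \<partial>lborel) + 2 * pi * (indicator {0..1} t * (Re (\<gamma>' t) * Im (\<gamma> t))) \<partial>lborel)"
    using i1 i2 by (subst Bochner_Integration.integral_add) auto
  have "\<bar>\<integral>t. (\<integral>w. F t w \<partial>lborel) + 2 * pi * (indicator {0..1} t * (Re (\<gamma>' t) * Im (\<gamma> t))) \<partial>lborel\<bar>
     \<le> (\<integral>t. norm ((\<integral>w. F t w \<partial>lborel) + 2 * pi * (indicator {0..1} t * (Re (\<gamma>' t) * Im (\<gamma> t)))) \<partial>lborel)"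
    unfolding real_norm_def[symmetric] by (rule integral_norm_bound)
  also have "\<dots> \<le> (\<integral>t. indicator {0..1::real} t * (2 * r * (B * e)) \<partial>lborel)"
  proof (rule integral_mono)
    show "integrable lborel (\<lambda>t. norm ((\<integral>w. F t w \<partial>lborel) + 2 * pi * (indicator {0..1} t * (Re (\<gamma>' t) * Im (\<gamma> t)))))"
      using i1 i2 by (intro integrable_norm Bochner_Integration.integrable_add)
    show "integrable lborel (\<lambda>t. indicator {0..1::real} t * (2 * r * (B * e)))"
      by (intro integrable_mult_left) (auto simp: integrable_indicator_iff)
    fix t :: real
    show "norm ((\<integral>w. F t w \<partial>lborel) + 2 * pi * (indicator {0..1} t * (Re (\<gamma>' t) * Im (\<gamma> t))))
        \<le> indicator {0..1} t * (2 * r * (B * e))"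
    proof (cases "t \<in> {0..1}")
      case True
      have "\<bar>(\<integral>w. F t w \<partial>lborel) + 2 * pi * (Re (\<gamma>' t) * Im (\<gamma> t))\<bar> \<le> 2 * r * (norm (\<gamma>' t) * e)"
        using integral_winding_kernel_box_approx[OF r[OF True] R, of "\<gamma>' t"] True by (simp add: F_def e_def)
      also have "\<dots> \<le> 2 * r * (B * e)"
        using B[OF True] e0 r0 by (intro mult_left_mono mult_right_mono) auto
      finally show ?thesis using True by simp
    qed (simp add: F_def)
  qed
  also have "\<dots> = 2 * r * (B * e)" by simp
  finally show ?thesis unfolding eq1 eq2 eq3 e_def .
qed

text \<open>The winding number is \<open>s\<close> inside and 0 outside. Every rectangle used
  contains the enclosed region, so the integral does not depend on \<open>R\<close>, while the error
  tends to 0 as \<open>R\<close> grows.\<close>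

theorem signed_area_eq:
  assumes sp: "simple_path \<gamma>" and loop: "pathfinish \<gamma> = pathstart \<gamma>"
    and s: "\<And>w. w \<in> inside (path_image \<gamma>) \<Longrightarrow> winding_number \<gamma> w = of_real s"
  shows "s * measure lborel {w. Complex (fst w) (snd w) \<in> inside (path_image \<gamma>)}
     = - integral {0..1} (\<lambda>t. Re (\<gamma>' t) * Im (\<gamma> t))"
proof -
  define D where "D = {w. Complex (fst w) (snd w) \<in> inside (path_image \<gamma>)}"
  define J where "J = integral {0..1} (\<lambda>t. Re (\<gamma>' t) * Im (\<gamma> t))"
  have "bounded (path_image \<gamma>)" by (simp add: bounded_simple_path_image sp)
  then obtain r where r: "r > 0" "\<And>z. z \<in> path_image \<gamma> \<Longrightarrow> norm z \<le> r"
    unfolding bounded_pos by auto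
  have r1: "\<bar>Re (\<gamma> t)\<bar> \<le> r" "\<bar>Im (\<gamma> t)\<bar> \<le> r" if "t \<in> {0..1}" for t
    using r(2)[of "\<gamma> t"] abs_Re_le_cmod[of "\<gamma> t"] abs_Im_le_cmod[of "\<gamma> t"] imageI[OF that, of \<gamma>]
    by (auto simp: path_image_def)
  obtain B where B: "\<And>t. t \<in> {0..1} \<Longrightarrow> norm (\<gamma>' t) \<le> B"
  proof -
    have "compact (\<gamma>' ` {0..1})" by (intro compact_continuous_image continuous_on_subset[OF continuous_deriv]) auto
    then obtain b where "\<forall>x\<in>\<gamma>' ` {0..1}. norm x \<le> b"
      unfolding compact_eq_bounded_closed bounded_pos by auto
    then show ?thesis by (intro that[of b]) auto
  qed
  have "open (inside (path_image \<gamma>))"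
    by (simp add: closed_path_image open_inside simple_path_imp_path sp)
  moreover have "continuous_on UNIV (\<lambda>w. Complex (fst w) (snd w))"
    unfolding Complex_eq by (intro continuous_intros)
  ultimately have "open D"
    unfolding D_def using open_vimage[of "inside (path_image \<gamma>)" "\<lambda>w. Complex (fst w) (snd w)"] by (simp add: vimage_def)
  then have Dm[measurable]: "D \<in> sets borel" by simp
  have sub: "inside (path_image \<gamma>) \<subseteq> cball 0 r"
    using r(2) by (intro inside_subset_convex) auto
  have DQ: "D \<subseteq> {-R..R} \<times> {-r..r}" if "r \<le> R" for R
  proof
    fix w assume "w \<in> D"
    then have "norm (Complex (fst w) (snd w)) \<le> r" using sub by (auto simp: D_def)
    then have "\<bar>fst w\<bar> \<le> r" "\<bar>snd w\<bar> \<le> r"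
      using abs_Re_le_cmod[of "Complex (fst w) (snd w)"] abs_Im_le_cmod[of "Complex (fst w) (snd w)"] by auto
    then show "w \<in> {-R..R} \<times> {-r..r}" using that by (auto simp: mem_Times_iff)
  qed
  have bound: "\<bar>2 * pi * (s * measure lborel D + J)\<bar> \<le> 2 * r * (B * (ln ((R + r) / (R - r)) + 4 * r / (R - r)))" if R: "r < R" for R
  proof -
    have eq: "(\<lambda>w. indicator ({-R..R} \<times> {-r..r}) w * (2 * pi * (s * indicator D w))) = (\<lambda>w. 2 * pi * s * indicator D w)"
      using DQ[of R] R by (auto simp: fun_eq_iff indicator_def)
    have "\<bar>(\<integral>w. indicator ({-R..R} \<times> {-r..r}) w * (2 * pi * (s * indicator D w)) \<partial>lborel) + 2 * pi * J\<bar>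
         \<le> 2 * r * (B * (ln ((R + r) / (R - r)) + 4 * r / (R - r)))"
      unfolding J_def
    proof (rule integral_winding_number_box_approx)
      fix w assume w: "Complex (fst w) (snd w) \<notin> path_image \<gamma>"
      show "s * indicator D w = Re (winding_number \<gamma> (Complex (fst w) (snd w)))"
      proof (cases "w \<in> D")
        case True then show ?thesis using s by (simp add: D_def)
      next
        case False
        then have "Complex (fst w) (snd w) \<in> outside (path_image \<gamma>)"
          using w by (simp add: D_def outside_inside)
        then show ?thesis using False winding_number_zero_in_outside[of \<gamma>] loop sp
          by (simp add: simple_path_imp_path)
      qed
    qed (use r1 B R in auto)
    then show ?thesis unfolding eq by (simp add: algebra_simps)
  qed
  have "((\<lambda>R. 2 * r * (B * (ln ((R + r) / (R - r)) + 4 * r / (R - r)))) \<longlongrightarrow> 0) at_top"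
    by real_asymp
  then have "\<bar>2 * pi * (s * measure lborel D + J)\<bar> \<le> 0"
    by (rule tendsto_lowerbound)
      (use bound in \<open>auto intro: eventually_mono[OF eventually_gt_at_top[of r]]\<close>)
  then show ?thesis unfolding D_def[symmetric] J_def[symmetric] by simp
qed

text \<open>At a point of the curve farthest from the origin the radial direction is normal to the curve,
  so the side of the curve pointing to the interior is known there.\<close>

theorem winding_number_inside_eq_1:
  assumes sp: "simple_path \<gamma>" and loop: "pathfinish \<gamma> = pathstart \<gamma>"
    and t0: "0 < t0" "t0 < 1" and T: "\<gamma>' t0 \<noteq> 0"
    and far: "\<And>t. t \<in> {0..1} \<Longrightarrow> norm (\<gamma> t) \<le> norm (\<gamma> t0)"
    and ins: "\<forall>\<^sub>F e in at_right 0. \<gamma> t0 + of_real e * (\<i> * \<gamma>' t0) \<in> inside (path_image \<gamma>)"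
    and w: "w \<in> inside (path_image \<gamma>)"
  shows "winding_number \<gamma> w = 1"
proof -
  define p where "p = \<gamma> t0"
  define T where "T = \<gamma>' t0"
  have T0: "T \<noteq> 0" using assms by (simp add: T_def)
  have path: "path \<gamma>" using sp by (rule simple_path_imp_path)
  have sub: "path_image \<gamma> \<subseteq> cball 0 (norm p)" using far by (auto simp: path_image_def p_def)
  have inside_sub: "inside (path_image \<gamma>) \<subseteq> cball 0 (norm p)"
    using sub by (intro inside_subset_convex) auto
  \<comment> \<open>The squared norm of the curve has a local maximum at the interior parameter
    \<open>t0\<close>.\<close>
  have perp: "\<gamma> t0 \<bullet> \<gamma>' t0 = 0"
  proof -
    have "((\<lambda>t. \<gamma> t \<bullet> \<gamma> t) has_vector_derivative (\<gamma> t0 \<bullet> \<gamma>' t0 + \<gamma>' t0 \<bullet> \<gamma> t0)) (at t0)"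
      using bounded_bilinear.has_vector_derivative[OF bounded_bilinear_inner deriv deriv] .
    then have "((\<lambda>t. \<gamma> t \<bullet> \<gamma> t) has_field_derivative (\<gamma> t0 \<bullet> \<gamma>' t0 + \<gamma>' t0 \<bullet> \<gamma> t0)) (at t0)"
      by (simp add: has_real_derivative_iff_has_vector_derivative)
    then have "\<gamma> t0 \<bullet> \<gamma>' t0 + \<gamma>' t0 \<bullet> \<gamma> t0 = 0"
    proof (rule DERIV_local_max)
      show "0 < min t0 (1 - t0)" using t0 by simp
      show "\<forall>y. \<bar>t0 - y\<bar> < min t0 (1 - t0) \<longrightarrow> \<gamma> y \<bullet> \<gamma> y \<le> \<gamma> t0 \<bullet> \<gamma> t0"
        using far by (auto simp: norm_le abs_if split: if_splits)
    qed
    then show ?thesis by (simp add: inner_commute)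
  qed
  \<comment> \<open>Perpendicularity makes \<open>p\<close> a real multiple \<open>\<mu>\<close> of
    the left normal \<open>\<i> * T\<close>, so moving along that normal stays on a line through the
    origin.\<close>
  define \<mu> where "\<mu> = Im (p / T)"
  have "Re (p / T) = 0" using perp by (simp add: p_def T_def Re_divide inner_complex_def)
  then have "p / T = \<i> * of_real \<mu>" by (simp add: complex_eq_iff \<mu>_def)
  then have p: "p = of_real \<mu> * (\<i> * T)" using T0 by (simp add: field_simps)
  have normp: "norm (p + of_real e * (\<i> * T)) = \<bar>\<mu> + e\<bar> * norm T" for e
  proof -
    have "p + of_real e * (\<i> * T) = of_real (\<mu> + e) * (\<i> * T)" by (simp add: p algebra_simps)
    then show ?thesis by (simp add: norm_mult del: of_real_add)
  qed
  have pos: "\<forall>\<^sub>F e::real in at_right 0. 0 < e" by (simp add: eventually_at_right_less)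
  \<comment> \<open>Small steps along \<open>\<i> * T\<close> land inside the curve, hence in the
    disc of radius \<open>norm p\<close>; for nonnegative \<open>\<mu>\<close> they would leave
    it.\<close>
  have \<mu>: "\<mu> < 0"
  proof -
    obtain e :: real where e: "0 < e" and "\<gamma> t0 + of_real e * (\<i> * \<gamma>' t0) \<in> inside (path_image \<gamma>)"
      using eventually_happens'[OF trivial_limit_at_right_real eventually_conj[OF pos ins]] by blast
    then have "norm (p + of_real e * (\<i> * T)) \<le> norm p" using inside_sub by (auto simp: p_def T_def)
    also have "norm p = \<bar>\<mu> + 0\<bar> * norm T" using normp[of 0] by simp
    finally have "\<bar>\<mu> + e\<bar> \<le> \<bar>\<mu>\<bar>" using T0 by (simp add: normp)
    then show ?thesis using e by linarith
  qed
  \<comment> \<open>Steps in the opposite direction leave the disc that contains the curve, so the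
    winding number there is 0.\<close>
  have out: "norm (p - of_real e * (\<i> * T)) > norm p" if "e > 0" for e
    using normp[of "-e"] normp[of 0] T0 \<mu> that by (simp add: left_diff_distrib)
  have wn0: "winding_number \<gamma> (p - of_real e * (\<i> * T)) = 0"
    and off: "p - of_real e * (\<i> * T) \<notin> path_image \<gamma>" if "e > 0" for e
  proof -
    show "p - of_real e * (\<i> * T) \<notin> path_image \<gamma>" using out[OF that] sub by auto
    show "winding_number \<gamma> (p - of_real e * (\<i> * T)) = 0"
      using out[OF that] by (intro winding_number_zero_outside[OF path convex_cball loop _ sub]) auto
  qed
  have ev: "\<forall>\<^sub>F e in at_right 0. \<gamma> t0 + of_real e * (\<i> * \<gamma>' t0) \<notin> path_image \<gamma> \<and>
                 \<gamma> t0 - of_real e * (\<i> * \<gamma>' t0) \<notin> path_image \<gamma>"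
    using pos ins
  proof eventually_elim
    fix e :: real assume "0 < e" "\<gamma> t0 + of_real e * (\<i> * \<gamma>' t0) \<in> inside (path_image \<gamma>)"
    then show "\<gamma> t0 + of_real e * (\<i> * \<gamma>' t0) \<notin> path_image \<gamma> \<and>
                 \<gamma> t0 - of_real e * (\<i> * \<gamma>' t0) \<notin> path_image \<gamma>"
      using off[of e] IntI[of _ "inside (path_image \<gamma>)" "path_image \<gamma>"]
      unfolding inside_no_overlap p_def T_def by blast
  qed
  have "t = t0" if "t \<in> {0..1}" "\<gamma> t = \<gamma> t0" for t
    using sp that t0 unfolding simple_path_def loop_free_def by fastforce
  from winding_number_jump_gt[OF t0 assms(5) this ev]
  have jump: "\<forall>\<^sub>F e in at_right 0. Re (winding_number \<gamma> (\<gamma> t0 + of_real e * (\<i> * \<gamma>' t0)))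
      - Re (winding_number \<gamma> (\<gamma> t0 - of_real e * (\<i> * \<gamma>' t0))) > -1" by blast
  obtain e :: real where e: "0 < e" and i: "\<gamma> t0 + of_real e * (\<i> * \<gamma>' t0) \<in> inside (path_image \<gamma>)"
      and "Re (winding_number \<gamma> (\<gamma> t0 + of_real e * (\<i> * \<gamma>' t0)))
      - Re (winding_number \<gamma> (\<gamma> t0 - of_real e * (\<i> * \<gamma>' t0))) > -1"
    using eventually_happens'[OF trivial_limit_at_right_real
        eventually_conj[OF pos eventually_conj[OF ins jump]]] by blast
  then have "Re (winding_number \<gamma> (\<gamma> t0 + of_real e * (\<i> * \<gamma>' t0))) > -1"
    using wn0[OF e] by (simp add: p_def T_def)
  then obtain w' where w': "w' \<in> inside (path_image \<gamma>)" "Re (winding_number \<gamma> w') > -1"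
    using i by blast
  \<comment> \<open>The winding number of a simple closed path is 1 at all inside points or -1 at
    all of them; the point \<open>w'\<close> excludes -1.\<close>
  show ?thesis
    using simple_closed_path_winding_number_inside[OF sp] w w' by (metis less_irrefl one_complex.sel(1) uminus_complex.sel(1))
qed

end

section \<open>Test functions for stability\<close>

text \<open>A family closed under both partial derivatives: one in \<open>t\<close> changes the
  coefficients \<open>c\<close> and \<open>d\<close>, one in \<open>s\<close> raises
  \<open>n\<close>. Smoothness of the test functions thus follows by induction on the list of
  derivatives.\<close>

definition tensor_trig :: "(real \<Rightarrow> real^2) \<Rightarrow> real \<Rightarrow> 2 \<Rightarrow> real \<Rightarrow> real \<Rightarrow> nat \<Rightarrow> real \<times> real \<Rightarrow> real" where
  "tensor_trig \<alpha> \<omega> i c d n = (\<lambda>(t, s). (c * sin (\<omega> * t) + d * cos (\<omega> * t)) * ((vderiv ^^ n) \<alpha> s $ i))"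

lemma smooth_curve_has_vector_derivative:
  assumes "smooth_curve \<alpha>"
  shows "((vderiv ^^ n) \<alpha> has_vector_derivative (vderiv ^^ Suc n) \<alpha> s) (at s)"
  using assms vector_derivative_works[of "(vderiv ^^ n) \<alpha>" "at s"]
  by (simp add: smooth_curve_def vderiv_def)

lemma smooth_curve_continuous:
  assumes "smooth_curve \<alpha>"
  shows "continuous_on S ((vderiv ^^ n) \<alpha>)"
  by (meson assms continuous_at_imp_continuous_on has_vector_derivative_continuous
      smooth_curve_has_vector_derivative)

lemma smooth_curve_has_field_derivative:
  assumes "smooth_curve \<alpha>"
  shows "((\<lambda>s. (vderiv ^^ n) \<alpha> s $ i) has_field_derivative (vderiv ^^ Suc n) \<alpha> s $ i) (at s)"
  using bounded_linear.has_vector_derivative[OF bounded_linear_vec_nth smooth_curve_has_vector_derivative[OF assms]]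
  unfolding has_real_derivative_iff_has_vector_derivative .

lemma smooth_curve_continuous_nth:
  assumes "smooth_curve \<alpha>"
  shows "continuous_on S (\<lambda>s. (vderiv ^^ n) \<alpha> s $ i)"
  by (intro continuous_on_component smooth_curve_continuous assms)

lemma pd_True_tensor_trig:
  "pd True (tensor_trig \<alpha> \<omega> i c d n) = tensor_trig \<alpha> \<omega> i (- (\<omega> * d)) (\<omega> * c) n"
proof (rule ext, clarify)
  fix t s
  have "((\<lambda>\<tau>. (c * sin (\<omega> * \<tau>) + d * cos (\<omega> * \<tau>)) * ((vderiv ^^ n) \<alpha> s $ i)) has_field_derivative
     (- (\<omega> * d) * sin (\<omega> * t) + \<omega> * c * cos (\<omega> * t)) * ((vderiv ^^ n) \<alpha> s $ i)) (at t)"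
    by (auto intro!: derivative_eq_intros)
  then show "pd True (tensor_trig \<alpha> \<omega> i c d n) (t, s) = tensor_trig \<alpha> \<omega> i (- (\<omega> * d)) (\<omega> * c) n (t, s)"
    by (simp add: pd_def tensor_trig_def DERIV_imp_deriv)
qed

lemma pd_False_tensor_trig:
  assumes "smooth_curve \<alpha>"
  shows "pd False (tensor_trig \<alpha> \<omega> i c d n) = tensor_trig \<alpha> \<omega> i c d (Suc n)"
proof (rule ext, clarify)
  fix t s
  have "((\<lambda>\<sigma>. (c * sin (\<omega> * t) + d * cos (\<omega> * t)) * ((vderiv ^^ n) \<alpha> \<sigma> $ i)) has_field_derivative
     (c * sin (\<omega> * t) + d * cos (\<omega> * t)) * ((vderiv ^^ Suc n) \<alpha> s $ i)) (at s)"
    by (intro DERIV_cmult smooth_curve_has_field_derivative assms)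
  then show "pd False (tensor_trig \<alpha> \<omega> i c d n) (t, s) = tensor_trig \<alpha> \<omega> i c d (Suc n) (t, s)"
    by (simp add: pd_def tensor_trig_def DERIV_imp_deriv)
qed

lemma differentiable_tensor_trig:
  assumes "smooth_curve \<alpha>"
  shows "tensor_trig \<alpha> \<omega> i c d n differentiable (at p)"
proof -
  have "((\<lambda>p. (vderiv ^^ n) \<alpha> (snd p) $ i) has_derivative (\<lambda>q. snd q * ((vderiv ^^ Suc n) \<alpha> (snd p) $ i))) (at p)"
    by (rule DERIV_compose_FDERIV[OF smooth_curve_has_field_derivative[OF assms]])
      (auto intro!: derivative_eq_intros)
  moreover have "(\<lambda>p. c * sin (\<omega> * fst p) + d * cos (\<omega> * fst p)) differentiable (at p)"
    unfolding differentiable_def by (rule exI) (auto intro!: derivative_eq_intros)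
  ultimately show ?thesis
    unfolding tensor_trig_def case_prod_beta' by (intro differentiable_mult) (auto simp: differentiable_def)
qed

lemma smooth2_tensor_trig:
  assumes "smooth_curve \<alpha>"
  shows "smooth2 (tensor_trig \<alpha> \<omega> i c d n)"
proof -
  have "fold pd ops (tensor_trig \<alpha> \<omega> i c d n) differentiable (at p)" for ops p
  proof (induction ops arbitrary: c d n)
    case (Cons b ops)
    show ?case
      using Cons.IH by (cases b) (simp_all add: pd_True_tensor_trig pd_False_tensor_trig assms)
  qed (simp add: differentiable_tensor_trig assms)
  then show ?thesis by (simp add: smooth2_def)
qed

lemma integral_tensor_product:
  fixes f g :: "real \<Rightarrow> real"
  assumes "continuous_on UNIV f" "continuous_on UNIV g"
  shows "integral (cbox (0, 0) (l, L)) (\<lambda>p. f (fst p) * g (snd p)) = integral {0..l} f * integral {0..L} g"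
proof -
  have "continuous_on (cbox (0, 0) (l, L)) (\<lambda>p. f (fst p) * g (snd p))"
    by (intro continuous_intros continuous_on_compose2[OF assms(1)] continuous_on_compose2[OF assms(2)]) auto
  from integral_prod_continuous[OF this] show ?thesis by simp
qed

lemma integral_sin_sq_half_period:
  fixes l :: real
  assumes "l > 0"
  shows "integral {0..l} (\<lambda>t. (sin (pi / l * t))\<^sup>2) = l / 2"
proof -
  have "((\<lambda>t. (sin (pi / l * t))\<^sup>2) has_integral
     ((l / 2 - sin (2 * (pi / l * l)) * l / (4 * pi)) - (0 / 2 - sin (2 * (pi / l * 0)) * l / (4 * pi)))) {0..l}"
  proof (rule fundamental_theorem_of_calculus)
    fix t
    have "((\<lambda>t. t / 2 - sin (2 * (pi / l * t)) * l / (4 * pi)) has_field_derivative 1 / 2 - cos (2 * (pi / l * t)) / 2) (at t within {0..l})"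
      using assms by (auto intro!: derivative_eq_intros simp: field_simps)
    also have "1 / 2 - cos (2 * (pi / l * t)) / 2 = (sin (pi / l * t))\<^sup>2"
      unfolding cos_double_sin by (simp add: diff_divide_distrib)
    finally show "((\<lambda>t. t / 2 - sin (2 * (pi / l * t)) * l / (4 * pi)) has_vector_derivative (sin (pi / l * t))\<^sup>2) (at t within {0..l})"
      by (simp add: has_real_derivative_iff_has_vector_derivative)
  qed (use assms in auto)
  then show ?thesis using assms by (simp add: integral_unique)
qed

section \<open>Derivatives of periodic and of unit-speed curves\<close>

lemma vderiv_periodic:
  assumes "smooth_curve \<alpha>" "\<forall>s. \<alpha> (s + L) = \<alpha> s"
  shows "vderiv \<alpha> (s + L) = vderiv \<alpha> s"
proof -
  have "(\<alpha> has_vector_derivative vderiv \<alpha> (s + L)) (at (s + L))"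
    using smooth_curve_has_vector_derivative[OF assms(1), of 0] by simp
  then have "((\<lambda>s. \<alpha> (s + L)) has_vector_derivative vderiv \<alpha> (s + L)) (at s)"
    using vector_diff_chain_at[of "\<lambda>s. s + L" 1 s \<alpha> "vderiv \<alpha> (s + L)"]
    by (simp add: o_def has_vector_derivative_add_const)
  then have "(\<alpha> has_vector_derivative vderiv \<alpha> (s + L)) (at s)"
    using assms(2) by simp
  then show ?thesis unfolding vderiv_def[of \<alpha>] by (metis vector_derivative_at)
qed

text \<open>Differentiate \<open>\<alpha>' \<bullet> \<alpha>' = 1\<close> twice. Lagrange's
  identity, with \<open>\<alpha>''\<close> perpendicular to the unit vector
  \<open>\<alpha>'\<close>, identifies the squared curvature with
  \<open>\<alpha>'' \<bullet> \<alpha>''\<close>.\<close>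

lemma unit_speed_frenet:
  assumes sm: "smooth_curve \<alpha>" and unit: "\<forall>s. norm (vderiv \<alpha> s) = 1"
  shows "vderiv \<alpha> s \<bullet> (vderiv ^^ 3) \<alpha> s + (curv \<alpha> s)\<^sup>2 = 0"
proof -
  define D where "D n = (vderiv ^^ n) \<alpha>" for n
  have d: "((\<lambda>s. D n s \<bullet> D m s) has_field_derivative D n s \<bullet> D (Suc m) s + D (Suc n) s \<bullet> D m s) (at s)" for n m s
    using bounded_bilinear.has_vector_derivative[OF bounded_bilinear_inner
        smooth_curve_has_vector_derivative[OF sm] smooth_curve_has_vector_derivative[OF sm]]
    unfolding has_real_derivative_iff_has_vector_derivative D_def .
  have D1: "D 1 s \<bullet> D 1 s = 1" for s using unit by (simp add: D_def dot_square_norm)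
  have D2: "D 1 s \<bullet> D 2 s = 0" for s
  proof -
    have "((\<lambda>s. 1) has_field_derivative D 1 s \<bullet> D 2 s + D 2 s \<bullet> D 1 s) (at s)"
      using d[of 1 1 s] by (simp add: D1 del: One_nat_def)
    then have "D 1 s \<bullet> D 2 s + D 2 s \<bullet> D 1 s = 0" by (rule DERIV_unique) simp
    then show ?thesis by (simp add: inner_commute)
  qed
  have D3: "D 1 s \<bullet> D 3 s + D 2 s \<bullet> D 2 s = 0"
  proof -
    have "((\<lambda>s. 0) has_field_derivative D 1 s \<bullet> D 3 s + D 2 s \<bullet> D 2 s) (at s)"
      using d[of 1 2 s] by (simp add: D2 del: One_nat_def)
    then show ?thesis by (rule DERIV_unique) simp
  qed
  have "(curv \<alpha> s)\<^sup>2 = D 2 s \<bullet> D 2 s"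
  proof -
    have "curv \<alpha> s = D 2 s $ 2 * D 1 s $ 1 - D 2 s $ 1 * D 1 s $ 2"
      by (simp add: curv_def rotJ_def D_def inner_vec_def sum_2 numeral_2_eq_2)
    moreover have "(D 2 s $ 2 * D 1 s $ 1 - D 2 s $ 1 * D 1 s $ 2)\<^sup>2
       = (D 2 s \<bullet> D 2 s) * (D 1 s \<bullet> D 1 s) - (D 1 s \<bullet> D 2 s)\<^sup>2"
      by (simp add: inner_vec_def sum_2 power2_eq_square algebra_simps)
    ultimately show ?thesis by (simp add: D1 D2 del: One_nat_def)
  qed
  then show ?thesis using D3 by (simp add: D_def)
qed

text \<open>Up to sign and order, the components of \<open>\<alpha>'\<close> used as test functions here are those of the normal.\<close>

lemma stable_column_imp_area_bound:
  assumes L: "L > 0" and l: "l > 0"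
    and sm: "smooth_curve \<alpha>" and per: "\<forall>s. \<alpha> (s + L) = \<alpha> s" and unit: "\<forall>s. norm (vderiv \<alpha> s) = 1"
    and stable: "stable_column a \<alpha> L l"
  shows "2 * a * integral {0..L} (\<lambda>s. \<alpha> s $ 1 * vderiv \<alpha> s $ 2 - \<alpha> s $ 2 * vderiv \<alpha> s $ 1) \<le> (pi / l)\<^sup>2 * L"
proof -
  define \<omega> where "\<omega> = pi / l"
  define D where "D n = (vderiv ^^ n) \<alpha>" for n
  have D01: "D 0 = \<alpha>" "D 1 = vderiv \<alpha>" by (auto simp: D_def)
  have cont: "continuous_on S (\<lambda>s. D n s $ i)" for n i S
    unfolding D_def by (rule smooth_curve_continuous_nth[OF sm])
  have pot: "continuous_on S (jacobi_pot a \<alpha>)" for S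
  proof -
    have "jacobi_pot a \<alpha> = (\<lambda>s. (D 2 s $ 2 * D 1 s $ 1 - D 2 s $ 1 * D 1 s $ 2)\<^sup>2 +
        2 * a * (D 0 s $ 1 * D 1 s $ 2 - D 0 s $ 2 * D 1 s $ 1))"
      by (rule ext) (simp add: jacobi_pot_def curv_def rotJ_def D_def inner_vec_def sum_2 numeral_2_eq_2)
    then show ?thesis by (auto intro!: continuous_intros cont)
  qed
  \<comment> \<open>The \<open>s\<close>-dependent factor of the integrand in the stability
    inequality for \<open>sin (\<omega> * t)\<close> times component \<open>i\<close> of
    \<open>\<alpha>'\<close>; each derivative pair in \<open>t\<close> gives
    \<open>- \<omega>^2\<close>.\<close>
  define g where "g i s = D 1 s $ i * (- \<omega>\<^sup>2 * D 1 s $ i + D 3 s $ i + jacobi_pot a \<alpha> s * D 1 s $ i)" for i s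
  have gc: "continuous_on S (g i)" for S i
    unfolding g_def by (intro continuous_intros cont pot)
  have gi: "integral {0..L} (g i) \<le> 0" for i
  proof -
    define u where "u = tensor_trig \<alpha> \<omega> i 1 0 1"
    have ueq: "u = (\<lambda>p. sin (\<omega> * fst p) * (D 1 (snd p) $ i))"
      by (auto simp: u_def tensor_trig_def D_def)
    have "integral {0..L} (\<lambda>s. D 1 s $ i) = D 0 L $ i - D 0 0 $ i"
    proof (rule integral_unique, rule fundamental_theorem_of_calculus)
      show "((\<lambda>s. D 0 s $ i) has_vector_derivative D 1 s $ i) (at s within {0..L})" for s
        using smooth_curve_has_field_derivative[OF sm, of 0 i s]
        unfolding has_real_derivative_iff_has_vector_derivative[symmetric] D_def
        by (auto intro: DERIV_subset)
    qed (use L in auto)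
    also have "\<dots> = 0" using per[rule_format, of 0] by (simp add: D01)
    finally have "integral (cbox (0, 0) (l, L)) u = 0"
      unfolding ueq by (subst integral_tensor_product) (auto intro!: continuous_intros cont)
    moreover have "u (0, s) = 0" "u (l, s) = 0" for s using l by (auto simp: ueq \<omega>_def)
    moreover have "u (t, s + L) = u (t, s)" for t s
      unfolding ueq by (simp add: D01 vderiv_periodic[OF sm per] del: One_nat_def)
    moreover have "smooth2 u" unfolding u_def by (rule smooth2_tensor_trig[OF sm])
    ultimately have "- integral (cbox (0, 0) (l, L))
            (\<lambda>p. u p * (pd True (pd True u) p + pd False (pd False u) p + jacobi_pot a \<alpha> (snd p) * u p)) \<ge> 0"
      using stable unfolding stable_column_def by blast
    moreover have "(\<lambda>p. u p * (pd True (pd True u) p + pd False (pd False u) p + jacobi_pot a \<alpha> (snd p) * u p))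
        = (\<lambda>p. (sin (\<omega> * fst p))\<^sup>2 * g i (snd p))"
      unfolding u_def pd_True_tensor_trig pd_False_tensor_trig[OF sm]
      by (auto simp: fun_eq_iff tensor_trig_def g_def D_def power2_eq_square algebra_simps numeral_3_eq_3)
    \<comment> \<open>The variables separate, and the integral of the squared sine is the positive
      number \<open>l / 2\<close>, so it can be divided out.\<close>
    ultimately have "integral {0..l} (\<lambda>t. (sin (\<omega> * t))\<^sup>2) * integral {0..L} (g i) \<le> 0"
      by (subst integral_tensor_product[symmetric]) (auto intro!: continuous_intros gc)
    then show ?thesis
      unfolding \<omega>_def integral_sin_sq_half_period[OF l] using l by (simp add: mult_le_0_iff)
  qed
  \<comment> \<open>Here \<open>D 1 s \<bullet> D 3 s\<close> cancels the squared curvature in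
    \<open>jacobi_pot\<close>, and unit speed removes the remaining derivatives outside the area
    form.\<close>
  have sum: "g 1 s + g 2 s = 2 * a * (\<alpha> s $ 1 * vderiv \<alpha> s $ 2 - \<alpha> s $ 2 * vderiv \<alpha> s $ 1) - \<omega>\<^sup>2" for s
  proof -
    have "g 1 s + g 2 s = (jacobi_pot a \<alpha> s - \<omega>\<^sup>2) * (D 1 s \<bullet> D 1 s) + D 1 s \<bullet> D 3 s"
      by (simp add: g_def inner_vec_def sum_2 algebra_simps)
    moreover have "D 1 s \<bullet> D 1 s = 1" using unit by (simp add: D01 dot_square_norm del: One_nat_def)
    moreover have "D 1 s \<bullet> D 3 s = - (curv \<alpha> s)\<^sup>2"
      using unit_speed_frenet[OF sm unit, of s] by (simp add: D_def)
    ultimately show ?thesis by (simp add: jacobi_pot_def)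
  qed
  define w where "w s = \<alpha> s $ 1 * vderiv \<alpha> s $ 2 - \<alpha> s $ 2 * vderiv \<alpha> s $ 1" for s
  have wc: "continuous_on S w" for S
    using continuous_on_diff[OF continuous_on_mult[OF cont[of _ 0 1] cont[of _ 1 2]]
        continuous_on_mult[OF cont[of _ 0 2] cont[of _ 1 1]]]
    unfolding w_def D01 .
  have "integral {0..L} (\<lambda>s. 2 * a * w s - \<omega>\<^sup>2) = integral {0..L} (g 1) + integral {0..L} (g 2)"
    by (subst integral_add[symmetric]) (auto simp: sum w_def intro!: integrable_continuous_interval gc)
  also have "\<dots> \<le> 0" using gi[of 1] gi[of 2] by simp
  also have "integral {0..L} (\<lambda>s. 2 * a * w s - \<omega>\<^sup>2) = 2 * a * integral {0..L} w - \<omega>\<^sup>2 * L"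
    using L by (subst integral_diff) (auto intro!: integrable_continuous_interval continuous_intros wc)
  finally show ?thesis unfolding w_def \<omega>_def by simp
qed

section \<open>The area enclosed by a periodic curve\<close>

lemma periodic_of_int:
  fixes f :: "real \<Rightarrow> 'a" and k :: int
  assumes "\<forall>s. f (s + L) = f s"
  shows "f (s + of_int k * L) = f s"
proof -
  have nat: "f (s + of_nat n * L) = f s" for n s
  proof (induction n)
    case (Suc n)
    have "f (s + of_nat (Suc n) * L) = f (s + of_nat n * L + L)" by (simp add: algebra_simps)
    also have "\<dots> = f s" using assms Suc.IH by simp
    finally show ?case .
  qed simp
  show ?thesis
  proof (cases k)
    case (nonneg n) then show ?thesis using nat by simp
  next
    case (neg n)
    have "s + of_int k * L + of_nat (Suc n) * L = s" unfolding neg by (simp add: algebra_simps)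
    then show ?thesis using nat[of "s + of_int k * L" "Suc n"] by metis
  qed
qed

lemma shift_into_period:
  fixes L c s :: real
  assumes "L > 0"
  obtains k :: int where "s + of_int k * L \<in> {c..<c + L}"
proof -
  define q where "q = (s - c) / L"
  have "s = c + q * L" using assms by (simp add: q_def)
  moreover have "of_int \<lfloor>q\<rfloor> * L \<le> q * L" using assms by (intro mult_right_mono) auto
  moreover have "q * L < (of_int \<lfloor>q\<rfloor> + 1) * L" using assms by (intro mult_strict_right_mono) linarith+
  ultimately have "s + of_int (- \<lfloor>q\<rfloor>) * L \<in> {c..<c + L}" by (simp add: algebra_simps)
  then show ?thesis by (rule that)
qed

lemma periodic_image_period:
  fixes f :: "real \<Rightarrow> 'a"
  assumes "L > 0" "\<forall>s. f (s + L) = f s"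
  shows "f ` {c..c + L} = range f"
proof
  show "range f \<subseteq> f ` {c..c + L}"
  proof clarify
    fix s
    obtain k :: int where "s + of_int k * L \<in> {c..<c + L}" using shift_into_period[OF assms(1)] by blast
    then show "f s \<in> f ` {c..c + L}"
      using periodic_of_int[OF assms(2), of s k] by (intro image_eqI[of _ _ "s + of_int k * L"]) auto
  qed
qed auto

text \<open>Shift both arguments into \<open>{0..<L}\<close> and use injectivity there. In this form
  injectivity is independent of the starting point of the parametrization.\<close>

lemma periodic_eq_imp_diff:
  fixes f :: "real \<Rightarrow> 'a"
  assumes L: "L > 0" and per: "\<forall>s. f (s + L) = f s" and inj: "inj_on f {0..<L}" and eq: "f x = f y"
  obtains k :: int where "x - y = of_int k * L"
proof -
  obtain i :: int where i: "x + of_int i * L \<in> {0..<0 + L}" using shift_into_period[OF L] by blast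
  obtain j :: int where j: "y + of_int j * L \<in> {0..<0 + L}" using shift_into_period[OF L] by blast
  have "x + of_int i * L = y + of_int j * L"
    using i j eq by (intro inj_onD[OF inj]) (auto simp: periodic_of_int[OF per])
  then have "x - y = of_int (j - i) * L" by (simp add: algebra_simps)
  then show ?thesis by (rule that)
qed

text \<open>For a primitive \<open>P\<close> of \<open>f\<close>, the difference
  \<open>P (x + L) - P x\<close> has derivative 0, so every interval of length \<open>L\<close>
  gives the same integral.\<close>

lemma integral_periodic_reparam:
  fixes f :: "real \<Rightarrow> real"
  assumes L: "L > 0" and cont: "continuous_on UNIV f" and per: "\<forall>s. f (s + L) = f s"
  shows "integral {0..1} (\<lambda>t. L * f (c + L * t)) = integral {0..L} f"
proof -
  obtain P where P: "\<And>x. (P has_vector_derivative f x) (at x)"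
    using einterval_antiderivative[of "-\<infinity>" "\<infinity>" f] cont by (auto simp: continuous_on_eq_continuous_at)
  have P': "(P has_field_derivative f x) (at x)" for x
    using P by (simp add: has_real_derivative_iff_has_vector_derivative)
  have "((\<lambda>x. P (x + L) - P x) has_field_derivative 0) (at x)" for x
  proof -
    have "((\<lambda>x. P (x + L)) has_field_derivative f (x + L)) (at x)" using P'[of "x + L"] unfolding DERIV_shift .
    from DERIV_diff[OF this P'[of x]] show ?thesis using per by simp
  qed
  then have const: "P (x + L) - P x = P (0 + L) - P 0" for x by (rule DERIV_isconst_all[rule_format])
  have "((\<lambda>t. L * f (c + L * t)) has_integral P (c + L * 1) - P (c + L * 0)) {0..1}"
  proof (rule fundamental_theorem_of_calculus)
    fix t :: real
    have "((\<lambda>t. P (c + L * t)) has_field_derivative f (c + L * t) * L) (at t within {0..1})"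
      by (rule DERIV_chain2[OF P']) (auto intro!: derivative_eq_intros)
    then show "((\<lambda>t. P (c + L * t)) has_vector_derivative L * f (c + L * t)) (at t within {0..1})"
      by (simp add: has_real_derivative_iff_has_vector_derivative mult.commute)
  qed simp
  moreover have "(f has_integral P L - P 0) {0..L}"
    using L P by (intro fundamental_theorem_of_calculus) (auto intro: has_vector_derivative_at_within)
  moreover have "P (c + L * 1) - P (c + L * 0) = P L - P 0" using const[of c] by simp
  ultimately show ?thesis by (metis integral_unique)
qed

text \<open>Reparametrize the curve over \<open>{0..1}\<close> in the complex plane;
  \<open>ccw\<close> at a farthest point makes the winding number 1 inside. Then the signed area
  formula gives the area as \<open>- \<integral> y dx\<close>.\<close>

theorem enclosed_area_eq:
  assumes L: "L > 0" and sm: "smooth_curve \<alpha>" and per: "\<forall>s. \<alpha> (s + L) = \<alpha> s"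
    and unit: "\<forall>s. norm (vderiv \<alpha> s) = 1" and inj: "inj_on \<alpha> {0..<L}"
    and ccw: "ccw \<alpha> (inside (\<alpha> ` {0..L}))"
  shows "integral {0..L} (\<lambda>s. \<alpha> s $ 1 * vderiv \<alpha> s $ 2 - \<alpha> s $ 2 * vderiv \<alpha> s $ 1)
     = 2 * measure lebesgue (inside (\<alpha> ` {0..L}))"
proof -
  have der: "(\<alpha> has_vector_derivative vderiv \<alpha> s) (at s)" for s
    using smooth_curve_has_vector_derivative[OF sm, of 0] by simp
  have cont: "continuous_on S \<alpha>" for S
    using smooth_curve_continuous[OF sm, of S 0] by simp
  have cont': "continuous_on S (vderiv \<alpha>)" for S
    using smooth_curve_continuous[OF sm, of S 1] by simp
  have rng: "range \<alpha> = \<alpha> ` {0..L}" using periodic_image_period[OF L per, of 0] by simp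
  have "compact (\<alpha> ` {0..L})" by (intro compact_continuous_image cont compact_Icc)
  then have comp: "compact (range \<alpha>)" by (simp add: rng)
  obtain s0 where s0: "\<And>s. norm (\<alpha> s) \<le> norm (\<alpha> s0)"
  proof -
    have "\<exists>x\<in>range \<alpha>. \<forall>y\<in>range \<alpha>. norm y \<le> norm x"
      by (rule continuous_attains_sup[OF comp]) (auto intro: continuous_intros)
    then show ?thesis using that by auto
  qed
  \<comment> \<open>Starting half a period before the farthest point puts that point at parameter
    1/2, away from the ends of \<open>{0..1}\<close>.\<close>
  define c where "c = s0 - L / 2"
  define \<gamma> where "\<gamma> t = complex_of_vec (\<alpha> (c + L * t))" for t
  define \<gamma>' where "\<gamma>' t = of_real L * complex_of_vec (vderiv \<alpha> (c + L * t))" for t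
  interpret C1_curve \<gamma> \<gamma>'
  proof
    fix t
    have "((\<alpha> \<circ> (\<lambda>t. c + L * t)) has_vector_derivative L *\<^sub>R vderiv \<alpha> (c + L * t)) (at t)"
      by (rule vector_diff_chain_at[OF _ der]) (auto intro!: derivative_eq_intros)
    from bounded_linear.has_vector_derivative[OF bounded_linear_complex_of_vec this]
    show "(\<gamma> has_vector_derivative \<gamma>' t) (at t)"
      unfolding \<gamma>_def \<gamma>'_def o_def complex_of_vec_scaleR .
  next
    have "continuous_on UNIV (\<lambda>t. complex_of_vec (vderiv \<alpha> (c + L * t)))"
      by (intro bounded_linear.continuous_on[OF bounded_linear_complex_of_vec]
          continuous_on_compose2[OF cont'[of UNIV]] continuous_intros) auto
    then show "continuous_on UNIV \<gamma>'" unfolding \<gamma>'_def by (intro continuous_intros)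
  qed
  have img: "path_image \<gamma> = complex_of_vec ` \<alpha> ` {0..L}"
  proof -
    have "(\<lambda>t. c + L * t) ` {0..1} = {c..c + L}"
      using image_affinity_atLeastAtMost[of L c 0 1] L by (simp add: add.commute)
    then have "path_image \<gamma> = complex_of_vec ` \<alpha> ` {c..c + L}"
      unfolding path_image_def \<gamma>_def by (metis (no_types, lifting) image_cong image_image)
    then show ?thesis by (simp add: periodic_image_period[OF L per] rng)
  qed
  have loop: "pathfinish \<gamma> = pathstart \<gamma>"
    using per by (simp add: pathfinish_def pathstart_def \<gamma>_def)
  have sp: "simple_path \<gamma>"
  proof (rule simple_pathI)
    show "path \<gamma>" using valid_path by (rule valid_path_imp_path)
    fix x y :: real assume xy: "0 \<le> x" "x < y" "y \<le> 1" "\<gamma> x = \<gamma> y"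
    then have "\<alpha> (c + L * y) = \<alpha> (c + L * x)" by (simp add: \<gamma>_def)
    then obtain k :: int where "(c + L * y) - (c + L * x) = of_int k * L"
      by (rule periodic_eq_imp_diff[OF L per inj])
    then have "L * (y - x) = L * of_int k" by (simp add: algebra_simps)
    then have k: "y - x = of_int k" using L by simp
    then have "0 < real_of_int k" "real_of_int k \<le> 1" using xy by linarith+
    then have "k = 1" by linarith
    then have "y - x = 1" using k by simp
    then show "x = 0 \<and> y = 1" using xy by linarith
  qed
  let ?\<Omega> = "inside (\<alpha> ` {0..L})"
  have ins: "inside (path_image \<gamma>) = complex_of_vec ` ?\<Omega>"
    unfolding img by (rule inside_complex_of_vec)
  have wn: "winding_number \<gamma> w = of_real 1" if "w \<in> inside (path_image \<gamma>)" for w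
    unfolding of_real_1
  proof (rule winding_number_inside_eq_1[OF sp loop _ _ _ _ _ that])
    show "0 < (1 / 2 :: real)" "1 / 2 < (1 :: real)" by auto
    have mid: "c + L * (1 / 2) = s0" by (simp add: c_def)
    have "norm (\<gamma>' (1 / 2)) = L" unfolding \<gamma>'_def using unit L by (simp add: norm_mult)
    then show "\<gamma>' (1 / 2) \<noteq> 0" using L by auto
    show "norm (\<gamma> t) \<le> norm (\<gamma> (1 / 2))" for t
      using s0 unfolding \<gamma>_def mid by simp
    obtain \<delta> where \<delta>: "\<delta> > 0" "\<And>\<epsilon>. 0 < \<epsilon> \<Longrightarrow> \<epsilon> < \<delta> \<Longrightarrow> \<alpha> s0 + \<epsilon> *\<^sub>R rotJ (vderiv \<alpha> s0) \<in> ?\<Omega>"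
      using ccw unfolding ccw_def by blast
    \<comment> \<open>The velocity \<open>\<gamma>'\<close> has length \<open>L\<close>, so a step
      \<open>e\<close> along its normal is a step \<open>e * L\<close> along the unit normal of
      \<alpha>.\<close>
    have "\<gamma> (1 / 2) + of_real e * (\<i> * \<gamma>' (1 / 2)) \<in> inside (path_image \<gamma>)" if e: "0 < e" "e < \<delta> / L" for e
    proof -
      have "\<gamma> (1 / 2) + of_real e * (\<i> * \<gamma>' (1 / 2)) = complex_of_vec (\<alpha> s0 + (e * L) *\<^sub>R rotJ (vderiv \<alpha> s0))"
        unfolding \<gamma>_def \<gamma>'_def mid
        by (simp add: complex_of_vec_add complex_of_vec_scaleR complex_of_vec_rotJ)
      then show ?thesis unfolding ins using \<delta>(2)[of "e * L"] e L by (auto simp: field_simps)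
    qed
    then show "\<forall>\<^sub>F e in at_right 0. \<gamma> (1 / 2) + of_real e * (\<i> * \<gamma>' (1 / 2)) \<in> inside (path_image \<gamma>)"
      unfolding eventually_at_right_field using \<delta>(1) L by (intro exI[of _ "\<delta> / L"]) auto
  qed
  define f where "f s = vderiv \<alpha> s $ 1 * \<alpha> s $ 2" for s
  have "open ?\<Omega>" by (intro open_inside compact_imp_closed \<open>compact (\<alpha> ` {0..L})\<close>)
  then have "measure lebesgue ?\<Omega> = measure lborel {w. Complex (fst w) (snd w) \<in> inside (path_image \<gamma>)}"
    unfolding ins by (intro measure_lebesgue_vec2) simp
  also have "\<dots> = - integral {0..1} (\<lambda>t. Re (\<gamma>' t) * Im (\<gamma> t))"
    using signed_area_eq[OF sp loop wn] by simp
  also have "(\<lambda>t. Re (\<gamma>' t) * Im (\<gamma> t)) = (\<lambda>t. L * f (c + L * t))"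
    by (simp add: \<gamma>_def \<gamma>'_def f_def complex_of_vec_def mult.assoc)
  also have "integral {0..1} (\<lambda>t. L * f (c + L * t)) = integral {0..L} f"
  proof (rule integral_periodic_reparam[OF L])
    show "continuous_on UNIV f" unfolding f_def by (intro continuous_intros cont cont')
    show "\<forall>s. f (s + L) = f s" using per vderiv_periodic[OF sm per] by (simp add: f_def)
  qed
  finally have area: "measure lebesgue ?\<Omega> = - integral {0..L} f" .
  \<comment> \<open>The derivative of \<open>x * y\<close> integrates to 0 over a period, so
    \<open>\<integral> x dy = - \<integral> y dx\<close> and the integral of
    \<open>x dy - y dx\<close> is twice the area.\<close>
  have "((\<lambda>s. \<alpha> s $ 1 * vderiv \<alpha> s $ 2 + vderiv \<alpha> s $ 1 * \<alpha> s $ 2) has_integral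
      \<alpha> L $ 1 * \<alpha> L $ 2 - \<alpha> 0 $ 1 * \<alpha> 0 $ 2) {0..L}"
  proof (rule fundamental_theorem_of_calculus)
    fix s
    have d: "((\<lambda>s. \<alpha> s $ i) has_field_derivative vderiv \<alpha> s $ i) (at s within {0..L})" for i
      using DERIV_subset[OF smooth_curve_has_field_derivative[OF sm, of 0 i s]] by simp
    show "((\<lambda>s. \<alpha> s $ 1 * \<alpha> s $ 2) has_vector_derivative \<alpha> s $ 1 * vderiv \<alpha> s $ 2 + vderiv \<alpha> s $ 1 * \<alpha> s $ 2) (at s within {0..L})"
      using DERIV_mult'[OF d[of 1] d[of 2]] by (simp add: has_real_derivative_iff_has_vector_derivative)
  qed (use L in simp)
  then have z: "((\<lambda>s. \<alpha> s $ 1 * vderiv \<alpha> s $ 2 + f s) has_integral 0) {0..L}"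
    using per[rule_format, of 0] by (simp add: f_def)
  have "(f has_integral integral {0..L} f) {0..L}"
    unfolding f_def by (intro integrable_integral integrable_continuous_interval continuous_intros cont cont')
  from has_integral_diff[OF z has_integral_mult_right[OF this, of 2]]
  have "((\<lambda>s. \<alpha> s $ 1 * vderiv \<alpha> s $ 2 - \<alpha> s $ 2 * vderiv \<alpha> s $ 1) has_integral - 2 * integral {0..L} f) {0..L}"
    by (simp add: f_def algebra_simps)
  then show ?thesis using area by (simp add: integral_unique)
qed

section \<open>The height bound for stable columns\<close>

theorem theorem1:
  fixes \<alpha> :: "real \<Rightarrow> real^2" and L l a b :: real
  assumes "L > 0" and "l > 0"
    and "smooth_curve \<alpha>"
    and "\<forall>s. \<alpha> (s + L) = \<alpha> s"
    and "\<forall>s. norm (vderiv \<alpha> s) = 1"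
    and "inj_on \<alpha> {0..<L}"
    and "ccw \<alpha> (inside (\<alpha> ` {0..L}))"
    and "\<forall>s. curv \<alpha> s = a * (norm (\<alpha> s))\<^sup>2 + b"
    and "a > 0"
    and "stable_column a \<alpha> L l"
  shows "l \<le> pi / 2 * sqrt (L / (a * measure lebesgue (inside (\<alpha> ` {0..L}))))"
proof -
  define m where "m = measure lebesgue (inside (\<alpha> ` {0..L}))"
  \<comment> \<open>Needed to divide by the area. The region is open, and \<open>ccw\<close>
    supplies a point in it, so it is not negligible; it is bounded, so its measure is
    finite.\<close>
  have "m > 0"
  proof -
    have "continuous_on {0..L} \<alpha>"
      using smooth_curve_continuous[OF assms(3), of _ 0] by simp
    then have comp: "compact (\<alpha> ` {0..L})" by (intro compact_continuous_image compact_Icc)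
    have op: "open (inside (\<alpha> ` {0..L}))" by (intro open_inside compact_imp_closed comp)
    moreover have "inside (\<alpha> ` {0..L}) \<noteq> {}"
      using assms(7) unfolding ccw_def by (metis dense empty_iff)
    ultimately have "\<not> negligible (inside (\<alpha> ` {0..L}))" by (simp add: open_not_negligible)
    moreover have "inside (\<alpha> ` {0..L}) \<in> lmeasurable"
      using op comp by (intro lmeasurable_open bounded_inside compact_imp_bounded)
    ultimately show ?thesis unfolding m_def by (simp add: negligible_iff_measure0 zero_less_measure_iff)
  qed
  \<comment> \<open>The area form integrates to \<open>2 * m\<close>, so the stability inequality
    becomes \<open>4 * a * m \<le> (pi / l)^2 * L\<close>, which is then solved for
    \<open>l\<close>.\<close>
  have "2 * a * (2 * m) \<le> (pi / l)\<^sup>2 * L"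
    using stable_column_imp_area_bound[OF assms(1-5,10)] enclosed_area_eq[OF assms(1,3-7)]
    by (simp add: m_def)
  then have "l\<^sup>2 \<le> (pi / 2)\<^sup>2 * (L / (a * m))"
    using \<open>l > 0\<close> \<open>a > 0\<close> \<open>m > 0\<close> by (simp add: field_simps)
  then have "sqrt (l\<^sup>2) \<le> sqrt ((pi / 2)\<^sup>2 * (L / (a * m)))" by (rule real_sqrt_le_mono)
  then show ?thesis using \<open>l > 0\<close> unfolding real_sqrt_mult m_def by simp
qed

end
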